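(* Let $k$ be a positive integer. For any $2k$-connected line graph $L(G)$ and any $S \subsetneq V(L(G))$ with $|S| \leq k$, the graph $L(G)-S$ has $k$ completely independent spanning trees if $G$ is not super edge-connected or $\delta(G) \geq 2k$.
   Context: All graphs are finite, simple and undirected. $L(G)$ is the line graph of $G$ (vertex set $E(G)$, two vertices adjacent iff the corresponding edges share an endpoint). $\delta(G)$ is the minimum degree of $G$. A graph is $k$-connected if its (vertex) connectivity is at least $k$. An edge-cut of a connected graph is a set of edges whose removal disconnects it; a connected graph is super edge-connected if every minimum edge-cut isolates a vertex. Spanning trees $T_1,\dots,T_k$ of a graph $H$ are completely independent if for any two distinct vertices $u,v$ of $H$, the $u$–$v$ paths in $T_1,\dots,T_k$ are pairwise edge-disjoint and pairwise share no vertex other than $u$ and $v$. *)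

theory Defs
  imports Main
begin

record 'a ugraph =
  verts :: "'a set"
  edges :: "'a set set"

definition simple_graph :: "'a ugraph \<Rightarrow> bool" where
  "simple_graph G \<longleftrightarrow> finite (verts G) \<and> (\<forall>e\<in>edges G. e \<subseteq> verts G \<and> card e = 2)"

definition degree :: "'a ugraph \<Rightarrow> 'a \<Rightarrow> nat" where
  "degree G v = card {e \<in> edges G. v \<in> e}"

text \<open>Only meaningful for finite graphs with at least one vertex.\<close>
definition min_degree :: "'a ugraph \<Rightarrow> nat" where
  "min_degree G = Min (degree G ` verts G)"

text \<open>Walks and paths are given by their nonempty lists of vertices.\<close>

fun walk_edges :: "'a list \<Rightarrow> 'a set set" where
  "walk_edges [] = {}"
| "walk_edges [x] = {}"
| "walk_edges (x # y # xs) = insert {x, y} (walk_edges (y # xs))"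

definition is_walk :: "'a ugraph \<Rightarrow> 'a list \<Rightarrow> bool" where
  "is_walk G p \<longleftrightarrow> p \<noteq> [] \<and> set p \<subseteq> verts G \<and> walk_edges p \<subseteq> edges G"

definition is_path :: "'a ugraph \<Rightarrow> 'a \<Rightarrow> 'a list \<Rightarrow> 'a \<Rightarrow> bool" where
  "is_path G u p v \<longleftrightarrow> is_walk G p \<and> distinct p \<and> hd p = u \<and> last p = v"

definition is_cycle :: "'a ugraph \<Rightarrow> 'a list \<Rightarrow> bool" where
  "is_cycle G p \<longleftrightarrow>
     is_walk G p \<and> distinct p \<and> 3 \<le> length p \<and> {last p, hd p} \<in> edges G"

text \<open>The graph without vertices does not count as connected.\<close>
definition graph_connected :: "'a ugraph \<Rightarrow> bool" where
  "graph_connected G \<longleftrightarrow>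
     verts G \<noteq> {} \<and> (\<forall>u\<in>verts G. \<forall>v\<in>verts G. \<exists>p. is_path G u p v)"

definition delete_verts :: "'a ugraph \<Rightarrow> 'a set \<Rightarrow> 'a ugraph" where
  "delete_verts G S = \<lparr>verts = verts G - S, edges = {e \<in> edges G. e \<inter> S = {}}\<rparr>"

definition delete_edges :: "'a ugraph \<Rightarrow> 'a set set \<Rightarrow> 'a ugraph" where
  "delete_edges G F = \<lparr>verts = verts G, edges = edges G - F\<rparr>"

text \<open>The least number of vertices whose deletion leaves a disconnected graph or at most
  one vertex; thus the complete graph on \<open>n \<ge> 1\<close> vertices has connectivity \<open>n - 1\<close>.\<close>
definition vertex_connectivity :: "'a ugraph \<Rightarrow> nat" where
  "vertex_connectivity G =
     (LEAST n. \<exists>S\<subseteq>verts G. card S = n \<and>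
        (\<not> graph_connected (delete_verts G S) \<or> card (verts G - S) \<le> 1))"

definition k_connected :: "nat \<Rightarrow> 'a ugraph \<Rightarrow> bool" where
  "k_connected k G \<longleftrightarrow> k \<le> vertex_connectivity G"

definition is_edge_cut :: "'a ugraph \<Rightarrow> 'a set set \<Rightarrow> bool" where
  "is_edge_cut G F \<longleftrightarrow> F \<subseteq> edges G \<and> \<not> graph_connected (delete_edges G F)"

definition is_minimum_edge_cut :: "'a ugraph \<Rightarrow> 'a set set \<Rightarrow> bool" where
  "is_minimum_edge_cut G F \<longleftrightarrow>
     is_edge_cut G F \<and> (\<forall>F'. is_edge_cut G F' \<longrightarrow> card F \<le> card F')"

definition isolates_vertex :: "'a ugraph \<Rightarrow> 'a set set \<Rightarrow> bool" where
  "isolates_vertex G F \<longleftrightarrow> (\<exists>v\<in>verts G. \<forall>e\<in>edges (delete_edges G F). v \<notin> e)"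

text \<open>Super edge-connectivity is a notion for connected graphs only: the negation of the
  following predicate also holds for every disconnected graph.\<close>
definition super_edge_connected :: "'a ugraph \<Rightarrow> bool" where
  "super_edge_connected G \<longleftrightarrow>
     graph_connected G \<and> (\<forall>F. is_minimum_edge_cut G F \<longrightarrow> isolates_vertex G F)"

definition line_graph :: "'a ugraph \<Rightarrow> 'a set ugraph" where
  "line_graph G =
     \<lparr>verts = edges G,
      edges = {{e, f} | e f. e \<in> edges G \<and> f \<in> edges G \<and> e \<noteq> f \<and> e \<inter> f \<noteq> {}}\<rparr>"

definition is_tree :: "'a ugraph \<Rightarrow> bool" where
  "is_tree T \<longleftrightarrow> simple_graph T \<and> graph_connected T \<and> (\<nexists>p. is_cycle T p)"

definition spanning_tree :: "'a ugraph \<Rightarrow> 'a ugraph \<Rightarrow> bool" where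
  "spanning_tree H T \<longleftrightarrow> is_tree T \<and> verts T = verts H \<and> edges T \<subseteq> edges H"

text \<open>The trees are \<open>T 0, \<dots>, T (k - 1)\<close>. Since paths in a tree are unique, quantifying over
  all paths between two vertices speaks about the unique such path.\<close>
definition completely_independent_spanning_trees ::
    "'a ugraph \<Rightarrow> nat \<Rightarrow> (nat \<Rightarrow> 'a ugraph) \<Rightarrow> bool" where
  "completely_independent_spanning_trees H k T \<longleftrightarrow>
     (\<forall>i<k. spanning_tree H (T i)) \<and>
     (\<forall>u\<in>verts H. \<forall>v\<in>verts H. u \<noteq> v \<longrightarrow>
        (\<forall>i<k. \<forall>j<k. i \<noteq> j \<longrightarrow>
           (\<forall>p q. is_path (T i) u p v \<and> is_path (T j) u q v \<longrightarrow>
              walk_edges p \<inter> walk_edges q = {} \<and> set p \<inter> set q \<subseteq> {u, v})))"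

end

theory Submission
  imports Defs "HOL-Library.Disjoint_Sets"
begin

text \<open>Either hypothesis on \<open>G\<close> upgrades the connectivity of \<open>L(G)\<close> to \<open>2k\<close>-edge-connectivity of \<open>G\<close>:
  an edge cut that isolates no vertex is a vertex cut of \<open>L(G)\<close>. Hence a partition of the vertices
  into \<open>m > 1\<close> parts has at least \<open>k m\<close> crossing edges, of which at least \<open>k (m - 1)\<close> survive the
  deletion of \<open>S\<close>, and by the theorem of Nash-Williams and Tutte \<open>G - S\<close> has \<open>k\<close> edge-disjoint
  spanning trees. Their edge sets contain the inner vertices of \<open>k\<close> completely independent spanning
  trees of \<open>L(G) - S = L(G - S)\<close>, in which all other edges are attached as leaves.\<close>

section \<open>Packing bases of a matroid\<close>

locale matroid_closure =
  fixes cl :: "'e set \<Rightarrow> 'e set"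
  assumes cl_mono: "A \<subseteq> B \<Longrightarrow> cl A \<subseteq> cl B"
    and cl_superset: "A \<subseteq> cl A"
    and cl_idem: "cl (cl A) \<subseteq> cl A"
    and cl_exchange: "x \<in> cl (insert y A) \<Longrightarrow> x \<notin> cl A \<Longrightarrow> y \<in> cl (insert x A)"
begin

lemma cl_least: "A \<subseteq> cl B \<Longrightarrow> cl A \<subseteq> cl B"
  using cl_mono cl_idem by blast

lemma cl_swap:
  assumes "x \<in> cl B" "y \<in> B" "x \<notin> cl (B - {y})"
  shows "cl (insert x (B - {y})) = cl B"
proof
  show "cl (insert x (B - {y})) \<subseteq> cl B"
    using assms(1) cl_superset[of B] by (intro cl_least) auto
  have "insert y (B - {y}) = B" using assms(2) by blast
  then have "y \<in> cl (insert x (B - {y}))"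
    using cl_exchange[of x y "B - {y}"] assms by simp
  then show "cl B \<subseteq> cl (insert x (B - {y}))"
    using cl_superset[of "insert x (B - {y})"] by (intro cl_least) auto
qed

definition indep :: "'e set \<Rightarrow> bool" where
  "indep A \<longleftrightarrow> (\<forall>a\<in>A. a \<notin> cl (A - {a}))"

lemma indep_empty: "indep {}"
  by (simp add: indep_def)

lemma indep_subset: "indep A \<Longrightarrow> B \<subseteq> A \<Longrightarrow> indep B"
  unfolding indep_def by (meson Diff_mono cl_mono order_refl subsetD)

lemma indep_insert:
  assumes "indep A" "x \<notin> cl A"
  shows "indep (insert x A)"
  unfolding indep_def
proof
  fix a assume a: "a \<in> insert x A"
  show "a \<notin> cl (insert x A - {a})"
  proof (cases "a = x")
    case True
    then have "cl (insert x A - {a}) \<subseteq> cl A"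
      by (intro cl_mono) auto
    then show ?thesis using assms(2) True by blast
  next
    case False
    then have eq: "insert x A - {a} = insert x (A - {a})" "insert a (A - {a}) = A"
      using a by auto
    show ?thesis
      using cl_exchange[of a x "A - {a}"] assms a False unfolding eq indep_def by auto
  qed
qed

lemma card_indep_le:
  assumes "finite B" "indep A" "A \<subseteq> cl B"
  shows "card A \<le> card B"
proof (cases "finite A")
  case True
  then show ?thesis using assms(2,3)
  proof (induction "card (A - B)" arbitrary: A rule: less_induct)
    case less
    show ?case
    proof (cases "A \<subseteq> B")
      case True
      then show ?thesis using assms(1) by (rule card_mono[rotated])
    next
      case False
      then obtain x where x: "x \<in> A" "x \<notin> B" by blast
      have "x \<notin> cl (A - {x})" using less.prems(2) x(1) by (simp add: indep_def)
      then have "\<not> B \<subseteq> cl (A - {x})" using cl_least less.prems(3) x(1) by blast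
      then obtain y where y: "y \<in> B" "y \<notin> cl (A - {x})" by blast
      then have "y \<notin> A - {x}" using cl_superset[of "A - {x}"] by blast
      define A' where "A' = insert y (A - {x})"
      have "indep A'"
        unfolding A'_def using less.prems(2) y(2) indep_subset by (intro indep_insert) blast+
      moreover have "A' \<subseteq> cl B"
        using less.prems(3) y(1) cl_superset[of B] by (auto simp: A'_def)
      moreover have "A' - B \<subset> A - B" using x y(1) by (auto simp: A'_def)
      then have "card (A' - B) < card (A - B)"
        using less.prems(1) by (intro psubset_card_mono) auto
      moreover have "finite A'" "card A' = card A"
        using less.prems(1) x(1) \<open>y \<notin> A - {x}\<close> card_Suc_Diff1[of A x] by (auto simp: A'_def)
      ultimately show ?thesis using less.hyps[of A'] by simp
    qed
  qed
qed simp

definition rank :: "'e set \<Rightarrow> nat" where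
  "rank A = Max (card ` {B. B \<subseteq> A \<and> indep B})"

lemma card_le_rank: "finite A \<Longrightarrow> B \<subseteq> A \<Longrightarrow> indep B \<Longrightarrow> card B \<le> rank A"
  unfolding rank_def by (intro Max_ge) auto

lemma rank_eq_card:
  assumes "finite A" "B \<subseteq> A" "indep B" "A \<subseteq> cl B"
  shows "rank A = card B"
  unfolding rank_def
  using assms by (intro Max_eqI) (auto intro!: card_indep_le intro: finite_subset)

lemma subset_cl_if_card_eq_rank:
  assumes "finite A" "B \<subseteq> A" "indep B" "card B = rank A"
  shows "A \<subseteq> cl B"
proof
  fix x assume "x \<in> A"
  show "x \<in> cl B"
  proof (rule ccontr)
    assume "x \<notin> cl B"
    then have "card (insert x B) \<le> rank A"
      using assms \<open>x \<in> A\<close> by (intro card_le_rank indep_insert) auto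
    moreover have "x \<notin> B" using \<open>x \<notin> cl B\<close> cl_superset by blast
    ultimately show False using assms finite_subset[of B A] by simp
  qed
qed

lemma basis_exists:
  assumes "finite A"
  obtains B where "B \<subseteq> A" "indep B" "A \<subseteq> cl B" "card B = rank A"
proof -
  have "{} \<in> {B. B \<subseteq> A \<and> indep B}" by (simp add: indep_empty)
  then have "rank A \<in> card ` {B. B \<subseteq> A \<and> indep B}"
    unfolding rank_def using assms by (intro Max_in) auto
  then obtain B where "B \<subseteq> A" "indep B" "card B = rank A" by auto
  then show thesis using that subset_cl_if_card_eq_rank[OF assms] by blast
qed

text \<open>The fundamental circuit without \<open>x\<close> itself.\<close>
definition fundamental_circuit :: "'e set \<Rightarrow> 'e \<Rightarrow> 'e set" where
  "fundamental_circuit A x = {y \<in> A. x \<notin> cl (A - {y})}"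

lemma in_cl_fundamental_circuit:
  assumes "finite A" "indep A" "x \<in> cl A"
  shows "x \<in> cl (fundamental_circuit A x)"
proof -
  obtain D where D: "D \<subseteq> A" "x \<in> cl D"
    and least: "\<And>D'. D' \<subseteq> A \<Longrightarrow> x \<in> cl D' \<Longrightarrow> card D \<le> card D'"
    using ex_has_least_nat[of "\<lambda>D. D \<subseteq> A \<and> x \<in> cl D" A card] assms(3) by blast
  have "x \<notin> cl (A - {y})" if y: "y \<in> D" for y
  proof
    assume x: "x \<in> cl (A - {y})"
    have "card (D - {y}) < card D"
      using y D(1) assms(1) by (meson card_Diff1_less finite_subset)
    then have "x \<notin> cl (D - {y})"
      using least[of "D - {y}"] D(1) by fastforce
    then have "y \<in> cl (insert x (D - {y}))"
      using cl_exchange[of x y "D - {y}"] D(2) y by (simp add: insert_absorb)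
    moreover have "insert x (D - {y}) \<subseteq> cl (A - {y})"
      using x D(1) cl_superset[of "A - {y}"] by auto
    ultimately have "y \<in> cl (A - {y})"
      using cl_least by blast
    then show False
      using y D(1) assms(2) by (auto simp: indep_def)
  qed
  then have "D \<subseteq> fundamental_circuit A x"
    using D(1) by (auto simp: fundamental_circuit_def)
  then show ?thesis using D(2) cl_mono by blast
qed

definition packing :: "'e set \<Rightarrow> nat \<Rightarrow> (nat \<Rightarrow> 'e set) \<Rightarrow> bool" where
  "packing E k I \<longleftrightarrow> (\<forall>i<k. I i \<subseteq> E \<and> indep (I i)) \<and> disjoint_family_on I {..<k}"

abbreviation covered :: "nat \<Rightarrow> (nat \<Rightarrow> 'e set) \<Rightarrow> 'e set" where
  "covered k I \<equiv> (\<Union>i<k. I i)"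

lemma finite_covered: "finite E \<Longrightarrow> packing E k I \<Longrightarrow> finite (covered k I)"
  by (auto simp: packing_def intro: finite_subset)

lemma packing_insert:
  assumes "packing E k I" "i < k" "e \<in> E - covered k I" "e \<notin> cl (I i)"
  shows "packing E k (I(i := insert e (I i)))"
    and "covered k (I(i := insert e (I i))) = insert e (covered k I)"
  using assms indep_insert[of "I i" e] unfolding packing_def disjoint_family_on_def
  by (auto split: if_splits)

lemma packing_swap:
  assumes "packing E k I" "i < k" "e \<in> E - covered k I" "y \<in> fundamental_circuit (I i) e"
  shows "packing E k (I(i := insert e (I i - {y})))"
    and "covered k (I(i := insert e (I i - {y}))) = insert e (covered k I - {y})"
proof -
  have disj: "I l \<inter> I m = {}" if "l < k" "m < k" "l \<noteq> m" for l m
    using assms(1) that unfolding packing_def disjoint_family_on_def by auto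
  have y: "y \<in> I i" "e \<notin> cl (I i - {y})"
    using assms(4) by (auto simp: fundamental_circuit_def)
  then have "indep (insert e (I i - {y}))"
    using assms(1,2) indep_subset[of "I i" "I i - {y}"]
    by (intro indep_insert) (auto simp: packing_def)
  then show "packing E k (I(i := insert e (I i - {y})))"
    using assms(1-3) disj unfolding packing_def disjoint_family_on_def by auto blast+
  show "covered k (I(i := insert e (I i - {y}))) = insert e (covered k I - {y})"
    using assms(2) y disj by (auto split: if_splits)
qed

definition maximum_packing :: "'e set \<Rightarrow> nat \<Rightarrow> (nat \<Rightarrow> 'e set) \<Rightarrow> bool" where
  "maximum_packing E k I \<longleftrightarrow>
     packing E k I \<and> (\<forall>J. packing E k J \<longrightarrow> card (covered k J) \<le> card (covered k I))"

lemma maximum_packing_exists: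
  assumes "finite E"
  obtains I where "maximum_packing E k I"
proof -
  have "packing E k (\<lambda>_. {})"
    by (simp add: packing_def indep_empty disjoint_family_on_def)
  moreover have "card (covered k J) < Suc (card E)" if "packing E k J" for J
    using that assms by (intro le_imp_less_Suc card_mono) (auto simp: packing_def)
  ultimately show thesis
    using that ex_has_greatest_nat[of "packing E k" _ "\<lambda>J. card (covered k J)" "Suc (card E)"]
    unfolding maximum_packing_def by blast
qed

lemma maximum_packing_swap:
  assumes fin: "finite E" and I: "maximum_packing E k I"
    and swap: "i < k" "e \<in> E - covered k I" "y \<in> fundamental_circuit (I i) e"
  shows "maximum_packing E k (I(i := insert e (I i - {y})))"
proof -
  have I': "packing E k I" using I by (simp add: maximum_packing_def)
  have "y \<in> covered k I" using swap by (auto simp: fundamental_circuit_def)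
  then have "card (insert e (covered k I - {y})) = card (covered k I)"
    using finite_covered[OF fin I'] swap(2) card_Suc_Diff1[of "covered k I" y] by simp
  then show ?thesis
    using I packing_swap[OF I' swap] unfolding maximum_packing_def by metis
qed

lemma uncovered_in_cl_maximum_packing:
  assumes "finite E" and I: "maximum_packing E k I" and e: "i < k" "e \<in> E - covered k I"
  shows "e \<in> cl (I i)"
proof (rule ccontr)
  assume "e \<notin> cl (I i)"
  have I': "packing E k I" using I by (simp add: maximum_packing_def)
  have "card (insert e (covered k I)) \<le> card (covered k I)"
    using I packing_insert[OF I' e \<open>e \<notin> cl (I i)\<close>] unfolding maximum_packing_def by metis
  then show False using finite_covered[OF assms(1) I'] e(2) by simp
qed

inductive swap_reachable ::
  "'e set \<Rightarrow> nat \<Rightarrow> (nat \<Rightarrow> 'e set) \<Rightarrow> (nat \<Rightarrow> 'e set) \<Rightarrow> bool"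
  for E :: "'e set" and k :: nat and I :: "nat \<Rightarrow> 'e set" where
  refl: "swap_reachable E k I I"
| swap: "\<lbrakk>swap_reachable E k I J; i < k; e \<in> E - covered k J; y \<in> fundamental_circuit (J i) e\<rbrakk>
    \<Longrightarrow> swap_reachable E k I (J(i := insert e (J i - {y})))"

text \<open>An uncovered element and its fundamental circuits are exposed, so swaps preserve the span of
  \<open>I i \<inter> exposed E k I\<close>. Shortest augmenting paths are not needed.\<close>
definition exposed :: "'e set \<Rightarrow> nat \<Rightarrow> (nat \<Rightarrow> 'e set) \<Rightarrow> 'e set" where
  "exposed E k I = (\<Union>J\<in>{J. swap_reachable E k I J}. E - covered k J)"

lemma uncovered_subset_exposed: "E - covered k I \<subseteq> exposed E k I"
  unfolding exposed_def using swap_reachable.refl by blast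

lemma swap_reachable_maximum_packing:
  assumes "finite E" "maximum_packing E k I" "swap_reachable E k I J"
  shows "maximum_packing E k J"
  using assms(3)
proof induction
  case (swap J i e y)
  then show ?case using assms(1) by (intro maximum_packing_swap)
qed (rule assms)

context
  fixes E :: "'e set" and k :: nat and I :: "nat \<Rightarrow> 'e set"
  assumes fin: "finite E" and max: "maximum_packing E k I"
begin

lemma fundamental_circuit_subset_exposed:
  assumes J: "swap_reachable E k I J" and e: "i < k" "e \<in> E - covered k J"
  shows "fundamental_circuit (J i) e \<subseteq> exposed E k I"
proof
  fix y assume y: "y \<in> fundamental_circuit (J i) e"
  have J': "packing E k J"
    using swap_reachable_maximum_packing[OF fin max J] by (simp add: maximum_packing_def)
  have "y \<in> J i" using y by (simp add: fundamental_circuit_def)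
  then have "y \<in> E - covered k (J(i := insert e (J i - {y})))"
    using J' e unfolding packing_swap(2)[OF J' e y] packing_def by blast
  then show "y \<in> exposed E k I"
    using swap_reachable.swap[OF J e y] unfolding exposed_def by blast
qed

lemma uncovered_in_cl_Int_exposed:
  assumes J: "swap_reachable E k I J" and e: "i < k" "e \<in> E - covered k J"
  shows "e \<in> cl (J i \<inter> exposed E k I)"
proof -
  have J': "maximum_packing E k J"
    using fin max J by (rule swap_reachable_maximum_packing)
  then have "finite (J i)" "indep (J i)"
    using e(1) fin by (auto simp: maximum_packing_def packing_def intro: finite_subset)
  then have "e \<in> cl (fundamental_circuit (J i) e)"
    using uncovered_in_cl_maximum_packing[OF fin J' e] by (rule in_cl_fundamental_circuit)
  moreover have "fundamental_circuit (J i) e \<subseteq> J i \<inter> exposed E k I"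
    using fundamental_circuit_subset_exposed[OF assms] by (auto simp: fundamental_circuit_def)
  ultimately show ?thesis using cl_mono by blast
qed

lemma cl_Int_exposed_swap_reachable:
  assumes "swap_reachable E k I J"
  shows "cl (J l \<inter> exposed E k I) = cl (I l \<inter> exposed E k I)"
  using assms
proof induction
  case (swap J i e y)
  let ?B = "J i \<inter> exposed E k I"
  have y: "y \<in> J i" "e \<notin> cl (J i - {y})" "y \<in> exposed E k I"
    using swap.hyps fundamental_circuit_subset_exposed[of J i e]
    by (auto simp: fundamental_circuit_def)
  have "e \<in> exposed E k I"
    using swap.hyps unfolding exposed_def by blast
  then have "insert e (J i - {y}) \<inter> exposed E k I = insert e (?B - {y})"
    by blast
  moreover have "e \<notin> cl (?B - {y})"
    using y(2) cl_mono[of "?B - {y}" "J i - {y}"] by blast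
  then have "cl (insert e (?B - {y})) = cl ?B"
    using uncovered_in_cl_Int_exposed[of J i e] swap.hyps y by (intro cl_swap) auto
  ultimately show ?case using swap.IH by (cases "l = i") auto
qed simp

lemma exposed_subset_cl:
  assumes "i < k"
  shows "exposed E k I \<subseteq> cl (I i \<inter> exposed E k I)"
  using uncovered_in_cl_Int_exposed[OF _ assms] cl_Int_exposed_swap_reachable
  unfolding exposed_def by blast

lemma card_Int_exposed:
  assumes "i < k"
  shows "card (I i \<inter> exposed E k I) = rank (exposed E k I)"
proof (rule rank_eq_card[symmetric])
  show "finite (exposed E k I)"
    using fin by (auto simp: exposed_def intro: finite_subset)
  have "indep (I i)" using max assms by (simp add: maximum_packing_def packing_def)
  then show "indep (I i \<inter> exposed E k I)" by (rule indep_subset) blast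
qed (use exposed_subset_cl[OF assms] in auto)

end

text \<open>Edmonds' theorem. A set \<open>R\<close> that is spanned by each \<open>I i \<inter> R\<close> and contains all uncovered
  elements turns the counting condition for \<open>R\<close> into an equality.\<close>
theorem base_packing:
  assumes fin: "finite E"
    and count: "\<And>A. A \<subseteq> E \<Longrightarrow> k * (rank E - rank A) \<le> card (E - A)"
  shows "\<exists>I. packing E k I \<and> (\<forall>i<k. E \<subseteq> cl (I i))"
proof -
  obtain I where max: "maximum_packing E k I"
    by (rule maximum_packing_exists[OF fin])
  then have packing: "packing E k I" by (simp add: maximum_packing_def)
  then have I: "I i \<subseteq> E" "indep (I i)" if "i < k" for i
    using that by (auto simp: packing_def)
  have finI: "finite (I i)" if "i < k" for i
    using I(1)[OF that] fin by (rule finite_subset)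
  define R where "R = exposed E k I"
  have R: "R \<subseteq> E" "E - covered k I \<subseteq> R"
    using uncovered_subset_exposed by (auto simp: R_def exposed_def)
  have inside: "card (I i \<inter> R) = rank R" if "i < k" for i
    unfolding R_def using that by (rule card_Int_exposed[OF fin max])
  have split: "card (I i) = rank R + card (I i - R)" if i: "i < k" for i
    using card_Int_Diff[OF finI[OF i], of R] inside[OF i] by simp
  have outside: "card (I i - R) \<le> rank E - rank R" if i: "i < k" for i
    using card_le_rank[OF fin I[OF i]] split[OF i] by simp
  have "(\<Sum>i<k. rank E - rank R) \<le> card (E - R)"
    using count[OF R(1)] by simp
  also have "E - R \<subseteq> (\<Union>i<k. I i - R)" using R(2) by blast
  then have "card (E - R) \<le> card (\<Union>i<k. I i - R)"
    using finI by (intro card_mono) auto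
  also have "\<dots> \<le> (\<Sum>i<k. card (I i - R))"
    by (rule card_UN_le) simp
  finally have lower: "(\<Sum>i<k. rank E - rank R) \<le> (\<Sum>i<k. card (I i - R))" .
  have equal: "(\<Sum>i<k. card (I i - R)) = (\<Sum>i<k. rank E - rank R)"
    by (rule antisym[OF sum_mono lower]) (rule outside, simp)
  have tight: "card (I i - R) = rank E - rank R" if "i < k" for i
    by (rule sum_mono_inv[OF equal]) (simp_all add: that outside)
  have "E \<subseteq> cl (I i)" if i: "i < k" for i
    using card_le_rank[OF fin I[OF i]] split[OF i] tight[OF i]
    by (intro subset_cl_if_card_eq_rank[OF fin I[OF i]]) simp
  then show ?thesis using packing by blast
qed

end

section \<open>Simple graphs and connectedness\<close>

lemma simple_graph_edgeE:
  assumes "simple_graph G" "e \<in> edges G"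
  obtains u v where "e = {u, v}" "u \<noteq> v" "u \<in> verts G" "v \<in> verts G"
  using assms unfolding simple_graph_def card_2_iff by (metis insert_subset)

lemma simple_graph_edge_eqI:
  assumes "simple_graph G" "e \<in> edges G" "f \<in> edges G" "{x, y} \<subseteq> e \<inter> f" "x \<noteq> y"
  shows "e = f"
proof -
  obtain a b c d where "e = {a, b}" "f = {c, d}"
    using simple_graph_edgeE[OF assms(1,2)] simple_graph_edgeE[OF assms(1,3)] by metis
  then show ?thesis using assms(4,5) by auto
qed

lemma simple_graph_finite_edges: "simple_graph G \<Longrightarrow> finite (edges G)"
  unfolding simple_graph_def by (meson PowI finite_Pow_iff finite_subset subsetI)

lemma simple_graph_restrict_edges: "simple_graph G \<Longrightarrow> F \<subseteq> edges G \<Longrightarrow> simple_graph (G\<lparr>edges := F\<rparr>)"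
  by (auto simp: simple_graph_def)

lemma simple_graph_delete_edges: "simple_graph G \<Longrightarrow> simple_graph (delete_edges G F)"
  by (auto simp: simple_graph_def delete_edges_def)

definition conn :: "'a set set \<Rightarrow> 'a rel" where
  "conn F = {(x, y). {x, y} \<in> F}\<^sup>*"

lemma conn_refl [simp]: "(x, x) \<in> conn F"
  by (simp add: conn_def)

lemma conn_edge: "{x, y} \<in> F \<Longrightarrow> (x, y) \<in> conn F"
  by (auto simp: conn_def)

lemma conn_trans: "(x, y) \<in> conn F \<Longrightarrow> (y, z) \<in> conn F \<Longrightarrow> (x, z) \<in> conn F"
  unfolding conn_def by (rule rtrancl_trans)

lemma conn_sym: "(x, y) \<in> conn F \<Longrightarrow> (y, x) \<in> conn F"
proof -
  have "sym {(x, y). {x, y} \<in> F}"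
    by (auto simp: sym_def insert_commute)
  then show "(x, y) \<in> conn F \<Longrightarrow> (y, x) \<in> conn F"
    unfolding conn_def by (meson sym_rtrancl symD)
qed

lemma equiv_conn: "equiv UNIV (conn F)"
proof (rule equivI)
  show "sym (conn F)" by (rule symI) (rule conn_sym)
  show "trans (conn F)" by (rule transI) (rule conn_trans)
qed (auto intro: refl_onI)

lemma conn_induct [consumes 1, case_names refl step]:
  assumes "(x, y) \<in> conn F" "P x"
    and "\<And>y z. (x, y) \<in> conn F \<Longrightarrow> {y, z} \<in> F \<Longrightarrow> P y \<Longrightarrow> P z"
  shows "P y"
  using assms unfolding conn_def by (induction rule: rtrancl_induct) auto

lemma conn_closed:
  assumes "(x, y) \<in> conn F" "\<Union>F \<subseteq> V" "x \<in> V"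
  shows "y \<in> V"
  using assms by (induction rule: conn_induct) auto

lemma conn_least:
  assumes "\<And>x y. {x, y} \<in> F \<Longrightarrow> (x, y) \<in> conn F'"
  shows "conn F \<subseteq> conn F'"
proof (rule subrelI)
  fix x y assume "(x, y) \<in> conn F"
  then show "(x, y) \<in> conn F'"
    by (induction rule: conn_induct) (auto intro: assms conn_trans)
qed

lemma conn_mono: "F \<subseteq> F' \<Longrightarrow> conn F \<subseteq> conn F'"
  by (rule conn_least) (auto intro: conn_edge)

lemma conn_insert:
  "(u, v) \<in> conn (insert {a, b} F) \<longleftrightarrow> (u, v) \<in> conn F \<or>
     (u, a) \<in> conn F \<and> (b, v) \<in> conn F \<or> (u, b) \<in> conn F \<and> (a, v) \<in> conn F"
proof -
  have "{(x, y). {x, y} \<in> insert {a, b} F} = insert (a, b) (insert (b, a) {(x, y). {x, y} \<in> F})"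
    by (auto simp: doubleton_eq_iff)
  then show ?thesis
    unfolding conn_def by (auto simp: rtrancl_insert intro: rtrancl_trans)
qed

definition components :: "'a set \<Rightarrow> 'a set set \<Rightarrow> 'a set set" where
  "components V F = V // conn F"

lemma finite_components: "finite V \<Longrightarrow> finite (components V F)"
  by (simp add: components_def quotient_def)

lemma card_components_pos: "finite V \<Longrightarrow> V \<noteq> {} \<Longrightarrow> 0 < card (components V F)"
  by (simp add: card_gt_0_iff finite_components) (simp add: components_def)

lemma partition_on_components:
  assumes "\<Union>F \<subseteq> V"
  shows "partition_on V (components V F)"
proof (rule partition_onI)
  show "\<Union>(components V F) = V"
  proof
    show "\<Union>(components V F) \<subseteq> V"
      using conn_closed[OF _ assms] by (auto simp: components_def elim!: quotientE)
    show "V \<subseteq> \<Union>(components V F)"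
      by (auto simp: components_def intro: quotientI)
  qed
  have sub: "components V F \<subseteq> UNIV // conn F"
    by (auto simp: components_def elim!: quotientE intro: quotientI)
  have partition: "partition_on UNIV (UNIV // conn F)"
    by (rule partition_on_quotient[OF equiv_conn])
  show "{} \<notin> components V F"
    using sub partition_onD3[OF partition] by blast
  show "disjnt X Y" if "X \<in> components V F" "Y \<in> components V F" "X \<noteq> Y" for X Y
    using partition_onD2[OF partition] sub that by (auto simp: disjoint_def disjnt_def)
qed

lemma conn_if_card_components_le_1:
  assumes "finite V" "card (components V F) \<le> 1"
  shows "V \<times> V \<subseteq> conn F"
proof (rule subrelI)
  fix u v assume "(u, v) \<in> V \<times> V"
  then have "conn F `` {u} \<in> components V F" "conn F `` {v} \<in> components V F"
    by (auto simp: components_def intro: quotientI)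
  then have "conn F `` {u} = conn F `` {v}"
    using assms finite_components[of V F] by (simp add: card_le_Suc0_iff_eq)
  then show "(u, v) \<in> conn F"
    using equiv_conn by (rule eq_equiv_class) simp
qed

lemma components_insert:
  assumes "a \<in> V" "b \<in> V" "(a, b) \<notin> conn F"
  defines "A \<equiv> conn F `` {a}" and "B \<equiv> conn F `` {b}"
  shows "components V (insert {a, b} F) = insert (A \<union> B) (components V F - {A, B})"
    and "A \<noteq> B" "{A, B} \<subseteq> components V F" "A \<union> B \<notin> components V F"
proof -
  have class_iff: "conn F `` {v} = A \<longleftrightarrow> (v, a) \<in> conn F" "conn F `` {v} = B \<longleftrightarrow> (v, b) \<in> conn F" for v
    by (simp_all add: A_def B_def eq_equiv_class_iff[OF equiv_conn])
  show "A \<noteq> B" "{A, B} \<subseteq> components V F"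
    using assms(1-3) class_iff(2)[of a] by (auto simp: A_def B_def components_def intro: quotientI)
  define merge where
    "merge X = X \<union> (if X = A then B else {}) \<union> (if X = B then A else {})" for X
  have "conn (insert {a, b} F) `` {v} = merge (conn F `` {v})" for v
    unfolding merge_def class_iff by (auto simp: A_def B_def conn_insert)
  then have "components V (insert {a, b} F) = merge ` components V F"
    by (simp add: components_def quotient_def image_UN)
  also have "components V F = insert A (insert B (components V F - {A, B}))"
    using \<open>{A, B} \<subseteq> components V F\<close> by blast
  also have "merge ` \<dots> = insert (A \<union> B) (merge ` (components V F - {A, B}))"
    using \<open>A \<noteq> B\<close> by (simp add: merge_def Un_commute)
  also have "merge ` (components V F - {A, B}) = components V F - {A, B}"
    by (simp add: merge_def)
  finally show "components V (insert {a, b} F) = insert (A \<union> B) (components V F - {A, B})" .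
  show "A \<union> B \<notin> components V F"
  proof
    assume "A \<union> B \<in> components V F"
    then obtain v where v: "A \<union> B = conn F `` {v}"
      unfolding components_def by (rule quotientE)
    have "a \<in> conn F `` {v}" "b \<in> conn F `` {v}"
      unfolding v[symmetric] by (simp_all add: A_def B_def)
    then show False using class_iff[of v] \<open>A \<noteq> B\<close> by simp
  qed
qed

lemma card_components_insert:
  assumes "finite V" "a \<in> V" "b \<in> V" "(a, b) \<notin> conn F"
  shows "Suc (card (components V (insert {a, b} F))) = card (components V F)"
proof -
  define A where "A = conn F `` {a}"
  define B where "B = conn F `` {b}"
  note merged = components_insert[OF assms(2-4), folded A_def B_def]
  have "card (components V F - {A, B}) = card (components V F) - 2"
    using merged(2,3) by (subst card_Diff_subset) auto
  moreover have "2 \<le> card (components V F)"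
    using card_mono[OF finite_components[OF assms(1)] merged(3)] merged(2) by simp
  ultimately show ?thesis
    using finite_components[OF assms(1)] merged(4) by (simp add: merged(1))
qed

section \<open>The cycle matroid\<close>

text \<open>Sets that are not of the form \<open>{u, v}\<close> belong to every span, like loops.\<close>
definition cycle_span :: "'a set set \<Rightarrow> 'a set set" where
  "cycle_span F = {e. \<forall>u v. e = {u, v} \<longrightarrow> (u, v) \<in> conn F}"

lemma conn_cycle_span: "conn (cycle_span F) \<subseteq> conn F"
  by (rule conn_least) (auto simp: cycle_span_def)

lemma conn_subset_if_subset_cycle_span: "F \<subseteq> cycle_span F' \<Longrightarrow> conn F \<subseteq> conn F'"
  using conn_mono conn_cycle_span by blast

lemma doubleton_in_cycle_span_iff: "{u, v} \<in> cycle_span F \<longleftrightarrow> (u, v) \<in> conn F"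
  by (auto simp: cycle_span_def doubleton_eq_iff intro: conn_sym)

interpretation cycle_matroid: matroid_closure cycle_span
proof
  show "cycle_span A \<subseteq> cycle_span B" if "A \<subseteq> B" for A B :: "'a set set"
    using conn_mono[OF that] by (auto simp: cycle_span_def)
  show "A \<subseteq> cycle_span A" for A :: "'a set set"
    by (auto simp: cycle_span_def intro: conn_edge)
  show "cycle_span (cycle_span A) \<subseteq> cycle_span A" for A :: "'a set set"
    using conn_cycle_span[of A] by (auto simp: cycle_span_def)
  show "y \<in> cycle_span (insert x A)"
    if x: "x \<in> cycle_span (insert y A)" "x \<notin> cycle_span A" for x y :: "'a set" and A
    unfolding cycle_span_def
  proof (intro CollectI allI impI)
    fix a b assume y: "y = {a, b}"
    obtain u v where uv: "x = {u, v}" "(u, v) \<notin> conn A"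
      using x(2) by (auto simp: cycle_span_def)
    then have "(u, v) \<in> conn (insert {a, b} A)"
      using x(1) y by (auto simp: cycle_span_def)
    then show "(a, b) \<in> conn (insert x A)"
      using uv(2) unfolding uv(1) conn_insert by (auto intro: conn_sym)
  qed
qed

lemma card_forest:
  assumes "simple_graph G" "F \<subseteq> edges G" "cycle_matroid.indep F"
  shows "card F + card (components (verts G) F) = card (verts G)"
proof -
  have "finite F"
    using assms(2) simple_graph_finite_edges[OF assms(1)] by (rule finite_subset)
  then show ?thesis using assms(2,3)
  proof (induction F)
    case empty
    have "conn {} = Id" by (simp add: conn_def)
    then have "components (verts G) {} = (\<lambda>v. {v}) ` verts G"
      by (auto simp: components_def quotient_def)
    then show ?case by (simp add: card_image)
  next
    case (insert e F)
    have "e \<in> edges G" using insert.prems(1) by simp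
    then obtain a b where ab: "e = {a, b}" "a \<in> verts G" "b \<in> verts G"
      by (rule simple_graph_edgeE[OF assms(1)])
    have "e \<notin> cycle_span F"
      using insert.prems(2) insert.hyps(2) unfolding cycle_matroid.indep_def by auto
    then have "Suc (card (components (verts G) (insert e F))) = card (components (verts G) F)"
      using card_components_insert[of "verts G" a b F] ab assms(1)
      by (simp add: doubleton_in_cycle_span_iff simple_graph_def)
    moreover have "card F + card (components (verts G) F) = card (verts G)"
      using insert cycle_matroid.indep_subset by blast
    ultimately show ?case using insert.hyps by simp
  qed
qed

lemma rank_cycle_matroid:
  assumes "simple_graph G" "F \<subseteq> edges G"
  shows "cycle_matroid.rank F + card (components (verts G) F) = card (verts G)"
proof -
  have "finite F"
    using assms(2) simple_graph_finite_edges[OF assms(1)] by (rule finite_subset)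
  then obtain B where B: "B \<subseteq> F" "cycle_matroid.indep B" "F \<subseteq> cycle_span B"
    "card B = cycle_matroid.rank F"
    by (rule cycle_matroid.basis_exists)
  have "conn B = conn F"
    using conn_mono[OF B(1)] conn_subset_if_subset_cycle_span[OF B(3)] by blast
  then show ?thesis
    using card_forest[OF assms(1) _ B(2)] B(1,4) assms(2) by (simp add: components_def)
qed

lemma rank_cycle_matroid_diff_le:
  assumes "simple_graph G" "verts G \<noteq> {}" "F \<subseteq> edges G"
  shows "cycle_matroid.rank (edges G) - cycle_matroid.rank F \<le> card (components (verts G) F) - 1"
proof -
  have "0 < card (components (verts G) (edges G))"
    using assms(1,2) by (intro card_components_pos) (simp_all add: simple_graph_def)
  then show ?thesis
    using rank_cycle_matroid[OF assms(1,3)] rank_cycle_matroid[OF assms(1) order_refl] by linarith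
qed

section \<open>Walks and rooted trees\<close>

lemma conn_walk:
  assumes "p \<noteq> []" "walk_edges p \<subseteq> F"
  shows "(hd p, last p) \<in> conn F"
  using assms
proof (induction p rule: walk_edges.induct)
  case (3 x y xs)
  then show ?case using conn_edge[of x y F] by (auto intro: conn_trans)
qed auto

lemma walk_edges_append:
  assumes "xs \<noteq> []" "ys \<noteq> []"
  shows "walk_edges (xs @ ys) = insert {last xs, hd ys} (walk_edges xs \<union> walk_edges ys)"
  using assms
proof (induction xs rule: walk_edges.induct)
  case (2 x)
  then show ?case by (cases ys) auto
qed auto

lemma conn_obtains_path:
  assumes "(u, v) \<in> conn F"
  obtains p where "p \<noteq> []" "distinct p" "hd p = u" "last p = v" "walk_edges p \<subseteq> F"
    "set p \<subseteq> insert u (\<Union>F)"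
proof -
  have "\<exists>p. p \<noteq> [] \<and> distinct p \<and> hd p = u \<and> last p = v \<and> walk_edges p \<subseteq> F
      \<and> set p \<subseteq> insert u (\<Union>F)"
    using assms
  proof (induction rule: conn_induct)
    case refl
    show ?case by (rule exI[of _ "[u]"]) simp
  next
    case (step y z)
    then obtain p where p: "p \<noteq> []" "distinct p" "hd p = u" "last p = y" "walk_edges p \<subseteq> F"
      "set p \<subseteq> insert u (\<Union>F)" by blast
    show ?case
    proof (cases "z \<in> set p")
      case True
      then obtain xs ys where "p = xs @ z # ys" by (auto simp: in_set_conv_decomp)
      then have eq: "p = (xs @ [z]) @ ys" by simp
      have "walk_edges (xs @ [z]) \<subseteq> walk_edges p"
        unfolding eq by (cases "ys = []") (auto simp: walk_edges_append simp del: append_assoc)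
      moreover have "hd (xs @ [z]) = u" using p(3) unfolding eq by (cases xs) auto
      ultimately show ?thesis
        using p unfolding eq by (intro exI[of _ "xs @ [z]"]) auto
    next
      case False
      then show ?thesis
        using p step.hyps(2) by (intro exI[of _ "p @ [z]"]) (auto simp: walk_edges_append)
    qed
  qed
  then show thesis using that by blast
qed

lemma graph_connected_iff_conn:
  assumes "simple_graph G"
  shows "graph_connected G \<longleftrightarrow> verts G \<noteq> {} \<and> verts G \<times> verts G \<subseteq> conn (edges G)"
proof -
  have "(\<exists>p. is_path G u p v) \<longleftrightarrow> (u, v) \<in> conn (edges G)" if u: "u \<in> verts G" for u v
  proof
    assume "\<exists>p. is_path G u p v"
    then show "(u, v) \<in> conn (edges G)"
      unfolding is_path_def is_walk_def using conn_walk by blast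
  next
    assume "(u, v) \<in> conn (edges G)"
    moreover have "insert u (\<Union>(edges G)) \<subseteq> verts G"
      using u assms by (auto simp: simple_graph_def)
    ultimately show "\<exists>p. is_path G u p v"
      unfolding is_path_def is_walk_def by (elim conn_obtains_path) blast
  qed
  then show ?thesis unfolding graph_connected_def by blast
qed

lemma walk_interior_neighbours:
  assumes "distinct p" "x \<in> set p" "x \<noteq> hd p" "x \<noteq> last p"
  obtains a b where "a \<in> set p" "b \<in> set p" "a \<noteq> b" "{a, x} \<in> walk_edges p" "{b, x} \<in> walk_edges p"
proof -
  obtain ys zs where p: "p = ys @ x # zs" using assms(2) by (auto simp: in_set_conv_decomp)
  have ne: "ys \<noteq> []" "zs \<noteq> []" using assms(3,4) p by auto
  show thesis
  proof
    show "last ys \<in> set p" "hd zs \<in> set p" using ne p by auto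
    show "last ys \<noteq> hd zs"
      using assms(1) p last_in_set[OF ne(1)] hd_in_set[OF ne(2)] by (auto simp: disjoint_iff)
    show "{last ys, x} \<in> walk_edges p" using ne p by (simp add: walk_edges_append)
    show "{hd zs, x} \<in> walk_edges p"
      using ne p walk_edges_append[of "[x]" zs] by (simp add: walk_edges_append insert_commute)
  qed
qed

lemma cycle_neighbours:
  assumes "is_cycle G p" "x \<in> set p"
  obtains a b where "a \<in> set p" "b \<in> set p" "a \<noteq> b" "{a, x} \<in> edges G" "{b, x} \<in> edges G"
proof -
  have dist: "distinct p" and walk: "walk_edges p \<subseteq> edges G" and len: "3 \<le> length p"
    and closing: "{last p, hd p} \<in> edges G"
    using assms(1) by (auto simp: is_cycle_def is_walk_def)
  consider (first) "x = hd p" | (last) "x = last p" | (interior) "x \<noteq> hd p" "x \<noteq> last p" by blast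
  then show thesis
  proof cases
    case first
    obtain y z zs where p: "p = x # y # z # zs"
      using len first by (auto simp: numeral_3_eq_3 Suc_le_length_iff)
    have "last p \<noteq> y" using dist p last_in_set[of "z # zs"] by auto
    then show ?thesis
      using that[of "last p" y] p closing walk last_in_set[of p] by (auto simp: insert_commute)
  next
    case last
    obtain ys where ys: "p = ys @ [x]" using last len by (cases p rule: rev_cases) auto
    then obtain zs y where p: "p = (zs @ [y]) @ [x]" using len by (cases ys rule: rev_cases) auto
    then obtain z zs' where zs: "zs = z # zs'" using len by (cases zs) auto
    have "{y, x} \<in> walk_edges p" unfolding p by (subst walk_edges_append) auto
    then show ?thesis
      using that[of y z] dist closing walk p zs by (auto simp: insert_commute)
  next
    case interior
    obtain a b where "a \<in> set p" "b \<in> set p" "a \<noteq> b" "{a, x} \<in> walk_edges p" "{b, x} \<in> walk_edges p"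
      by (rule walk_interior_neighbours[OF dist assms(2) interior])
    then show ?thesis using walk by (intro that[of a b]) auto
  qed
qed

lemma path_interior_degree_ge_2:
  assumes "simple_graph G" "is_path G u p v" "x \<in> set p" "x \<noteq> u" "x \<noteq> v"
  shows "2 \<le> degree G x"
proof -
  have "distinct p" "x \<noteq> hd p" "x \<noteq> last p" and walk: "walk_edges p \<subseteq> edges G"
    using assms by (auto simp: is_path_def is_walk_def)
  then obtain a b where ab: "a \<noteq> b" "{a, x} \<in> walk_edges p" "{b, x} \<in> walk_edges p"
    using walk_interior_neighbours[of p x] assms(3) by metis
  then have "card {{a, x}, {b, x}} \<le> degree G x"
    unfolding degree_def using walk simple_graph_finite_edges[OF assms(1)] by (intro card_mono) auto
  moreover have "{a, x} \<noteq> {b, x}" using ab(1) by (auto simp: doubleton_eq_iff)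
  ultimately show ?thesis by simp
qed

definition parent_function :: "'a set \<Rightarrow> 'a \<Rightarrow> ('a \<Rightarrow> 'a) \<Rightarrow> bool" where
  "parent_function V r \<pi> \<longleftrightarrow>
     r \<in> V \<and> (\<exists>d :: 'a \<Rightarrow> nat. \<forall>v\<in>V - {r}. \<pi> v \<in> V \<and> d (\<pi> v) < d v)"

definition parent_graph :: "'a set \<Rightarrow> 'a \<Rightarrow> ('a \<Rightarrow> 'a) \<Rightarrow> 'a ugraph" where
  "parent_graph V r \<pi> = \<lparr>verts = V, edges = (\<lambda>v. {v, \<pi> v}) ` (V - {r})\<rparr>"

lemma parent_function_in: "parent_function V r \<pi> \<Longrightarrow> v \<in> V - {r} \<Longrightarrow> \<pi> v \<in> V"
  by (auto simp: parent_function_def)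

lemma inj_on_parent_edge:
  assumes "parent_function V r \<pi>"
  shows "inj_on (\<lambda>v. {v, \<pi> v}) (V - {r})"
proof (rule inj_onI)
  obtain d :: "'a \<Rightarrow> nat" where d: "\<And>v. v \<in> V - {r} \<Longrightarrow> d (\<pi> v) < d v"
    using assms unfolding parent_function_def by blast
  fix x y assume "x \<in> V - {r}" "y \<in> V - {r}" "{x, \<pi> x} = {y, \<pi> y}"
  then show "x = y" using d[of x] d[of y] by (auto simp: doubleton_eq_iff)
qed

lemma simple_graph_parent_graph:
  assumes "finite V" "parent_function V r \<pi>"
  shows "simple_graph (parent_graph V r \<pi>)"
proof -
  obtain d :: "'a \<Rightarrow> nat" where d: "\<And>v. v \<in> V - {r} \<Longrightarrow> \<pi> v \<in> V \<and> d (\<pi> v) < d v"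
    using assms(2) unfolding parent_function_def by blast
  have "{v, \<pi> v} \<subseteq> V \<and> card {v, \<pi> v} = 2" if "v \<in> V - {r}" for v
  proof -
    have "v \<noteq> \<pi> v" using d[OF that] by force
    then show ?thesis using d[OF that] that by simp
  qed
  then show ?thesis using assms(1) by (auto simp: simple_graph_def parent_graph_def)
qed

lemma graph_connected_parent_graph:
  assumes "finite V" "parent_function V r \<pi>"
  shows "graph_connected (parent_graph V r \<pi>)" (is "graph_connected ?T")
proof -
  obtain d :: "'a \<Rightarrow> nat" where d: "\<And>v. v \<in> V - {r} \<Longrightarrow> \<pi> v \<in> V \<and> d (\<pi> v) < d v"
    using assms(2) unfolding parent_function_def by blast
  have root: "(v, r) \<in> conn (edges ?T)" if "v \<in> V" for v
    using that
  proof (induction "d v" arbitrary: v rule: less_induct)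
    case less
    show ?case
    proof (cases "v = r")
      case False
      then have "(v, \<pi> v) \<in> conn (edges ?T)" "(\<pi> v, r) \<in> conn (edges ?T)"
        using less d by (auto simp: parent_graph_def intro: conn_edge)
      then show ?thesis by (rule conn_trans)
    qed simp
  qed
  then have "(u, v) \<in> conn (edges ?T)" if "u \<in> V" "v \<in> V" for u v
    using that conn_trans conn_sym by metis
  moreover have "verts ?T = V" "V \<noteq> {}"
    using assms(2) by (auto simp: parent_graph_def parent_function_def)
  ultimately show ?thesis
    using graph_connected_iff_conn[OF simple_graph_parent_graph[OF assms]] by auto
qed

text \<open>Both neighbours of a vertex of maximal depth on a cycle would have to be its parent.\<close>
lemma acyclic_parent_graph:
  assumes "parent_function V r \<pi>"
  shows "\<not> is_cycle (parent_graph V r \<pi>) p"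
proof
  assume p: "is_cycle (parent_graph V r \<pi>) p"
  obtain d :: "'a \<Rightarrow> nat" where d: "\<And>v. v \<in> V - {r} \<Longrightarrow> d (\<pi> v) < d v"
    using assms unfolding parent_function_def by blast
  have "p \<noteq> []" using p by (auto simp: is_cycle_def)
  then have "Max (d ` set p) \<in> d ` set p" by simp
  then obtain x where x: "x \<in> set p" "d x = Max (d ` set p)" by auto
  then have deepest: "d y \<le> d x" if "y \<in> set p" for y using that by simp
  have parent: "y = \<pi> x" if y: "y \<in> set p" "{y, x} \<in> edges (parent_graph V r \<pi>)" for y
  proof -
    obtain v where v: "v \<in> V - {r}" "{y, x} = {v, \<pi> v}"
      using y(2) by (auto simp: parent_graph_def)
    then have "y = v \<Longrightarrow> x = \<pi> v \<Longrightarrow> False" using d[of v] deepest[OF y(1)] by auto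
    then show ?thesis using v(2) by (auto simp: doubleton_eq_iff)
  qed
  show False
    by (rule cycle_neighbours[OF p x(1)]) (use parent in metis)
qed

lemma is_tree_parent_graph:
  assumes "finite V" "parent_function V r \<pi>"
  shows "is_tree (parent_graph V r \<pi>)"
  unfolding is_tree_def
  using simple_graph_parent_graph[OF assms] graph_connected_parent_graph[OF assms]
    acyclic_parent_graph[OF assms(2)] by blast

text \<open>The parent of \<open>v\<close> is a neighbour that is closer to \<open>r\<close>.\<close>
lemma graph_connected_parent_function:
  assumes "simple_graph G" "graph_connected G" "r \<in> verts G"
  obtains \<pi> where "parent_function (verts G) r \<pi>"
    "\<And>v. v \<in> verts G - {r} \<Longrightarrow> {v, \<pi> v} \<in> edges G"
proof -
  define A where "A = {(x, y). {x, y} \<in> edges G}"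
  define d where "d v = (LEAST n. (r, v) \<in> A ^^ n)" for v
  have "\<exists>y. {v, y} \<in> edges G \<and> d y < d v" if v: "v \<in> verts G - {r}" for v
  proof -
    have "(r, v) \<in> A\<^sup>*"
      using assms v unfolding graph_connected_iff_conn[OF assms(1)] conn_def A_def by blast
    then have "\<exists>n. (r, v) \<in> A ^^ n" by (rule rtrancl_imp_relpow)
    then have dist: "(r, v) \<in> A ^^ d v" unfolding d_def by (rule LeastI_ex)
    then obtain m where m: "d v = Suc m" using v by (cases "d v") auto
    then obtain y where y: "(r, y) \<in> A ^^ m" "(y, v) \<in> A" using dist by auto
    have "d y \<le> m" unfolding d_def using y(1) by (rule Least_le)
    then show ?thesis
      using y(2) m by (intro exI[of _ y]) (auto simp: A_def insert_commute)
  qed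
  then obtain \<pi> where \<pi>: "{v, \<pi> v} \<in> edges G" "d (\<pi> v) < d v" if "v \<in> verts G - {r}" for v
    by metis
  have "\<pi> v \<in> verts G" if "v \<in> verts G - {r}" for v
    using \<pi>(1)[OF that] assms(1) by (auto simp: simple_graph_def)
  then have "parent_function (verts G) r \<pi>"
    unfolding parent_function_def using \<pi>(2) assms(3) by blast
  then show thesis using that \<pi>(1) by blast
qed

lemma spanning_tree_exists:
  assumes "simple_graph G" "graph_connected G"
  obtains T where "spanning_tree G T"
proof -
  obtain r where r: "r \<in> verts G" using assms(2) by (auto simp: graph_connected_def)
  then obtain \<pi> where \<pi>: "parent_function (verts G) r \<pi>"
    "\<And>v. v \<in> verts G - {r} \<Longrightarrow> {v, \<pi> v} \<in> edges G"
    by (rule graph_connected_parent_function[OF assms]) blast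
  have "is_tree (parent_graph (verts G) r \<pi>)"
    using \<pi>(1) assms(1) by (intro is_tree_parent_graph) (auto simp: simple_graph_def)
  then have "spanning_tree G (parent_graph (verts G) r \<pi>)"
    using \<pi>(2) by (auto simp: spanning_tree_def parent_graph_def)
  then show thesis by (rule that)
qed

lemma parent_function_attach_leaves:
  assumes "parent_function A r \<pi>" "A \<subseteq> V" "\<And>v. v \<in> V - A \<Longrightarrow> \<phi> v \<in> A"
  shows "parent_function V r (\<lambda>v. if v \<in> A then \<pi> v else \<phi> v)"
proof -
  obtain d :: "'a \<Rightarrow> nat" where d: "\<And>v. v \<in> A - {r} \<Longrightarrow> \<pi> v \<in> A \<and> d (\<pi> v) < d v"
    using assms(1) unfolding parent_function_def by blast
  define d' where "d' v = (if v \<in> A then d v else Suc (d (\<phi> v)))" for v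
  let ?\<pi> = "\<lambda>v. if v \<in> A then \<pi> v else \<phi> v"
  have "?\<pi> v \<in> V \<and> d' (?\<pi> v) < d' v" if "v \<in> V - {r}" for v
    using d[of v] assms(2,3) that by (auto simp: d'_def)
  moreover have "r \<in> V"
    using assms(1,2) by (auto simp: parent_function_def)
  ultimately show ?thesis unfolding parent_function_def by blast
qed

lemma degree_parent_graph_le_1:
  assumes "x \<notin> \<pi> ` (V - {r})"
  shows "degree (parent_graph V r \<pi>) x \<le> 1"
proof -
  have "{e \<in> edges (parent_graph V r \<pi>). x \<in> e} \<subseteq> {{x, \<pi> x}}"
    using assms by (auto simp: parent_graph_def)
  then show ?thesis
    using card_mono[of "{{x, \<pi> x}}"] by (fastforce simp: degree_def)
qed

section \<open>The tree packing theorem\<close>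

definition edge_disjoint_spanning_trees :: "'a ugraph \<Rightarrow> nat \<Rightarrow> (nat \<Rightarrow> 'a ugraph) \<Rightarrow> bool" where
  "edge_disjoint_spanning_trees G k T \<longleftrightarrow>
     (\<forall>i<k. spanning_tree G (T i)) \<and> disjoint_family_on (\<lambda>i. edges (T i)) {..<k}"

definition crossing_edges :: "'a ugraph \<Rightarrow> 'a set set \<Rightarrow> 'a set set" where
  "crossing_edges G P = {e \<in> edges G. \<forall>X\<in>P. \<not> e \<subseteq> X}"

lemma crossing_edges_components:
  assumes "simple_graph G"
  shows "crossing_edges G (components (verts G) F) \<subseteq> edges G - F"
proof
  fix e assume e: "e \<in> crossing_edges G (components (verts G) F)"
  then have "e \<in> edges G" by (simp add: crossing_edges_def)
  then obtain u v where uv: "e = {u, v}" "u \<in> verts G"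
    by (rule simple_graph_edgeE[OF assms])
  have "conn F `` {u} \<in> components (verts G) F"
    using uv(2) by (simp add: components_def quotientI)
  then have "\<not> e \<subseteq> conn F `` {u}" using e by (auto simp: crossing_edges_def)
  then have "e \<notin> F" using uv(1) conn_edge[of u v F] by auto
  then show "e \<in> edges G - F" using \<open>e \<in> edges G\<close> by blast
qed

lemma edge_disjoint_spanning_trees_if_connected_subgraphs:
  assumes G: "simple_graph G"
    and I: "\<And>i. i < k \<Longrightarrow> I i \<subseteq> edges G \<and> graph_connected (G\<lparr>edges := I i\<rparr>)"
    and disj: "disjoint_family_on I {..<k}"
  obtains T where "edge_disjoint_spanning_trees G k T"
proof -
  have "\<exists>T. spanning_tree (G\<lparr>edges := I i\<rparr>) T" if "i < k" for i
    using I[OF that] simple_graph_restrict_edges[OF G] spanning_tree_exists by metis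
  then obtain T where T: "spanning_tree (G\<lparr>edges := I i\<rparr>) (T i)" if "i < k" for i
    by metis
  have sub: "edges (T i) \<subseteq> I i" if "i < k" for i
    using T[OF that] by (simp add: spanning_tree_def)
  have "spanning_tree G (T i)" if "i < k" for i
    using T[OF that] I[OF that] by (auto simp: spanning_tree_def)
  moreover have "disjoint_family_on (\<lambda>i. edges (T i)) {..<k}"
    using disj sub unfolding disjoint_family_on_def by blast
  ultimately show thesis
    using that[of T] by (simp add: edge_disjoint_spanning_trees_def)
qed

lemma graph_connected_restrict_edges:
  assumes "simple_graph G" "graph_connected G" "F \<subseteq> edges G" "edges G \<subseteq> cycle_span F"
  shows "graph_connected (G\<lparr>edges := F\<rparr>)"
  using assms(2) conn_subset_if_subset_cycle_span[OF assms(4)]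
    graph_connected_iff_conn[OF assms(1)]
    graph_connected_iff_conn[OF simple_graph_restrict_edges[OF assms(1,3)]]
  by auto

text \<open>The nontrivial direction of the theorem of Nash-Williams and Tutte.\<close>
theorem tree_packing:
  assumes G: "simple_graph G" "verts G \<noteq> {}"
    and cross: "\<And>P. partition_on (verts G) P \<Longrightarrow> k * (card P - 1) \<le> card (crossing_edges G P)"
  obtains T where "edge_disjoint_spanning_trees G k T"
proof -
  have finV: "finite (verts G)" using G(1) by (simp add: simple_graph_def)
  have finE: "finite (edges G)" using G(1) by (rule simple_graph_finite_edges)
  have cross_components: "k * (card (components (verts G) F) - 1) \<le> card (edges G - F)"
    if "F \<subseteq> edges G" for F
  proof -
    have "\<Union>F \<subseteq> verts G" using G(1) that by (auto simp: simple_graph_def)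
    then have "k * (card (components (verts G) F) - 1)
        \<le> card (crossing_edges G (components (verts G) F))"
      by (intro cross partition_on_components)
    also have "\<dots> \<le> card (edges G - F)"
      using finE by (intro card_mono crossing_edges_components[OF G(1)]) simp
    finally show ?thesis .
  qed
  have "k * (cycle_matroid.rank (edges G) - cycle_matroid.rank F) \<le> card (edges G - F)"
    if "F \<subseteq> edges G" for F
    using mult_le_mono2[OF rank_cycle_matroid_diff_le[OF G that]] cross_components[OF that]
    by (rule order_trans)
  then obtain I where I: "cycle_matroid.packing (edges G) k I"
    and span: "\<And>i. i < k \<Longrightarrow> edges G \<subseteq> cycle_span (I i)"
    using cycle_matroid.base_packing[OF finE] by blast
  have "I i \<subseteq> edges G \<and> graph_connected (G\<lparr>edges := I i\<rparr>)" if "i < k" for i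
  proof
    show sub: "I i \<subseteq> edges G" using I that by (simp add: cycle_matroid.packing_def)
    have "card (components (verts G) (edges G)) \<le> 1"
      using cross_components[of "edges G"] that by simp
    then have "graph_connected G"
      using conn_if_card_components_le_1[OF finV] G by (simp add: graph_connected_iff_conn)
    then show "graph_connected (G\<lparr>edges := I i\<rparr>)"
      using G(1) sub span[OF that] by (intro graph_connected_restrict_edges)
  qed
  moreover have "disjoint_family_on I {..<k}"
    using I by (simp add: cycle_matroid.packing_def)
  ultimately show thesis
    using that by (rule edge_disjoint_spanning_trees_if_connected_subgraphs[OF G(1)])
qed

section \<open>Edge-connectivity\<close>

definition k_edge_connected :: "nat \<Rightarrow> 'a ugraph \<Rightarrow> bool" where
  "k_edge_connected m G \<longleftrightarrow> (\<forall>F. is_edge_cut G F \<longrightarrow> m \<le> card F)"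

definition edge_boundary :: "'a ugraph \<Rightarrow> 'a set \<Rightarrow> 'a set set" where
  "edge_boundary G X = {e \<in> edges G. e \<inter> X \<noteq> {} \<and> \<not> e \<subseteq> X}"

lemma is_edge_cut_edge_boundary:
  assumes "simple_graph G" "X \<noteq> {}" "X \<subset> verts G"
  shows "is_edge_cut G (edge_boundary G X)"
  unfolding is_edge_cut_def
proof
  show "edge_boundary G X \<subseteq> edges G" by (auto simp: edge_boundary_def)
  obtain x y where xy: "x \<in> X" "y \<in> verts G" "y \<notin> X" using assms(2,3) by blast
  let ?D = "delete_edges G (edge_boundary G X)"
  have "z \<in> X" if "(x, z) \<in> conn (edges ?D)" for z
    using that xy(1)
    by (induction rule: conn_induct) (auto simp: delete_edges_def edge_boundary_def)
  then have "(x, y) \<notin> conn (edges ?D)" using xy by blast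
  moreover have "x \<in> verts ?D" "y \<in> verts ?D"
    using assms xy by (auto simp: delete_edges_def)
  ultimately show "\<not> graph_connected ?D"
    using graph_connected_iff_conn[OF simple_graph_delete_edges[OF assms(1)]] by blast
qed

text \<open>Every crossing edge lies in the boundary of exactly two parts.\<close>
lemma sum_card_edge_boundary:
  assumes G: "simple_graph G" and P: "partition_on (verts G) P"
  shows "(\<Sum>X\<in>P. card (edge_boundary G X)) = 2 * card (crossing_edges G P)"
proof -
  have unique: "X = Y" if "X \<in> P" "Y \<in> P" "x \<in> X" "x \<in> Y" for X Y x
    using P that by (meson disjoint_iff disjointD partition_onD2)
  have "finite P"
    using G P by (auto simp: simple_graph_def intro: finite_elements)
  have "edge_boundary G X = {e \<in> crossing_edges G P. e \<inter> X \<noteq> {}}" if X: "X \<in> P" for X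
  proof -
    have "\<not> e \<subseteq> Z" if "e \<inter> X \<noteq> {}" "\<not> e \<subseteq> X" "Z \<in> P" for e Z
      using that unique X by blast
    then show ?thesis using X unfolding edge_boundary_def crossing_edges_def by blast
  qed
  then have "(\<Sum>X\<in>P. card (edge_boundary G X)) =
      (\<Sum>X\<in>P. card {e \<in> crossing_edges G P. e \<inter> X \<noteq> {}})"
    by simp
  also have "\<dots> = (\<Sum>e\<in>crossing_edges G P. card {X \<in> P. e \<inter> X \<noteq> {}})"
    using \<open>finite P\<close> simple_graph_finite_edges[OF G]
    by (intro sum_multicount_gen) (auto simp: crossing_edges_def)
  also have "\<dots> = (\<Sum>e\<in>crossing_edges G P. 2)"
  proof (rule sum.cong[OF HOL.refl])
    fix e assume e: "e \<in> crossing_edges G P"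
    then have "e \<in> edges G" by (simp add: crossing_edges_def)
    then obtain u v where uv: "e = {u, v}" "u \<in> verts G" "v \<in> verts G"
      by (rule simple_graph_edgeE[OF G])
    then obtain X Y where XY: "X \<in> P" "u \<in> X" "Y \<in> P" "v \<in> Y"
      using partition_onD1[OF P] by blast
    then have "{X \<in> P. e \<inter> X \<noteq> {}} = {X, Y}"
      using unique uv(1) by blast
    moreover have "X \<noteq> Y" using e uv(1) XY by (auto simp: crossing_edges_def)
    ultimately show "card {X \<in> P. e \<inter> X \<noteq> {}} = 2" by simp
  qed
  finally show ?thesis by simp
qed

lemma k_edge_connected_crossing_edges_ge:
  assumes G: "simple_graph G" "k_edge_connected (2 * k) G"
    and P: "partition_on (verts G) P" "card P > 1"
  shows "k * card P \<le> card (crossing_edges G P)"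
proof -
  have "2 * k \<le> card (edge_boundary G X)" if X: "X \<in> P" for X
  proof -
    have "P \<noteq> {X}" using P(2) by auto
    then obtain Y where Y: "Y \<in> P" "Y \<noteq> X" using X by blast
    then have "X \<inter> Y = {}" using P(1) X by (metis disjointD partition_onD2)
    moreover have "X \<noteq> {}" "Y \<noteq> {}"
      using partition_onD3[OF P(1)] X Y(1) by blast+
    ultimately have "X \<noteq> {}" "X \<subset> verts G"
      using partition_onD1[OF P(1)] X Y(1) by blast+
    then show ?thesis
      using G(2) is_edge_cut_edge_boundary[OF G(1)] by (simp add: k_edge_connected_def)
  qed
  then have "(\<Sum>X\<in>P. 2 * k) \<le> (\<Sum>X\<in>P. card (edge_boundary G X))"
    by (rule sum_mono)
  then show ?thesis by (simp add: sum_card_edge_boundary[OF G(1) P(1)] mult.commute)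
qed

theorem k_edge_connected_edge_disjoint_spanning_trees:
  assumes G: "simple_graph G" "verts G \<noteq> {}" "k_edge_connected (2 * k) G"
    and S: "finite S" "card S \<le> k"
  obtains T where "edge_disjoint_spanning_trees (delete_edges G S) k T"
proof (rule tree_packing)
  show "simple_graph (delete_edges G S)" using G(1) by (rule simple_graph_delete_edges)
  show "verts (delete_edges G S) \<noteq> {}" using G(2) by (simp add: delete_edges_def)
  fix P assume "partition_on (verts (delete_edges G S)) P"
  then have P: "partition_on (verts G) P" by (simp add: delete_edges_def)
  show "k * (card P - 1) \<le> card (crossing_edges (delete_edges G S) P)"
  proof (cases "card P > 1")
    case True
    have "k * (card P - 1) \<le> k * card P - card S"
      using S(2) by (simp add: diff_mult_distrib2)
    also have "\<dots> \<le> card (crossing_edges G P) - card S"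
      using k_edge_connected_crossing_edges_ge[OF G(1,3) P True] by (rule diff_le_mono)
    also have "\<dots> \<le> card (crossing_edges G P - S)"
      using S(1) by (rule diff_card_le_card_Diff)
    also have "crossing_edges G P - S = crossing_edges (delete_edges G S) P"
      by (auto simp: crossing_edges_def delete_edges_def)
    finally show ?thesis .
  qed simp
qed (rule that)

section \<open>Line graphs\<close>

lemma simple_graph_line_graph:
  assumes "simple_graph G"
  shows "simple_graph (line_graph G)"
  using simple_graph_finite_edges[OF assms]
  by (auto simp: simple_graph_def line_graph_def card_2_iff)

lemma delete_verts_line_graph: "delete_verts (line_graph G) S = line_graph (delete_edges G S)"
  by (auto simp: delete_verts_def line_graph_def delete_edges_def)

lemma edges_line_graphI:
  "e \<in> edges G \<Longrightarrow> f \<in> edges G \<Longrightarrow> e \<noteq> f \<Longrightarrow> x \<in> e \<inter> f \<Longrightarrow> {e, f} \<in> edges (line_graph G)"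
  by (simp add: line_graph_def) blast

lemma edges_line_graphE:
  assumes "h \<in> edges (line_graph G)"
  obtains e f x where "h = {e, f}" "e \<in> edges G" "f \<in> edges G" "e \<noteq> f" "x \<in> e \<inter> f"
  using assms unfolding line_graph_def by auto

lemma conn_line_graph:
  assumes "x \<in> e \<inter> f" "e \<in> edges G" "f \<in> edges G"
  shows "(e, f) \<in> conn (edges (line_graph G))"
proof (cases "e = f")
  case False
  then show ?thesis using assms by (intro conn_edge edges_line_graphI)
qed simp

lemma graph_connected_line_graph:
  assumes G: "simple_graph G" "graph_connected G" "edges G \<noteq> {}"
  shows "graph_connected (line_graph G)"
proof -
  have "(e, f) \<in> conn (edges (line_graph G))" if ef: "e \<in> edges G" "f \<in> edges G" for e f
  proof -
    obtain u w where u: "u \<in> e" "u \<in> verts G" and w: "w \<in> f" "w \<in> verts G"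
      using ef simple_graph_edgeE[OF G(1)] by (metis insertI1)
    then have "(u, w) \<in> conn (edges G)"
      using G(2) graph_connected_iff_conn[OF G(1)] by blast
    then have "\<forall>f\<in>edges G. w \<in> f \<longrightarrow> (e, f) \<in> conn (edges (line_graph G))"
    proof (induction rule: conn_induct)
      case refl
      show ?case using u(1) ef(1) by (auto intro: conn_line_graph[of u])
    next
      case (step y z)
      show ?case
      proof (intro ballI impI)
        fix f assume "f \<in> edges G" "z \<in> f"
        then have "({y, z}, f) \<in> conn (edges (line_graph G))"
          using step.hyps(2) by (intro conn_line_graph[of z]) auto
        with step.IH step.hyps(2) show "(e, f) \<in> conn (edges (line_graph G))"
          by (blast intro: conn_trans)
      qed
    qed
    then show ?thesis using w(1) ef(2) by blast
  qed
  then show ?thesis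
    using G(3) graph_connected_iff_conn[OF simple_graph_line_graph[OF G(1)]]
    by (auto simp: line_graph_def)
qed

lemma graph_connected_if_line_graph:
  assumes G: "simple_graph G" "graph_connected (line_graph G)"
    and covered: "\<And>v. v \<in> verts G \<Longrightarrow> \<exists>e\<in>edges G. v \<in> e"
  shows "graph_connected G"
proof -
  have edge_conn: "(x, y) \<in> conn (edges G)" if "e \<in> edges G" "x \<in> e" "y \<in> e" for e x y
  proof (cases "x = y")
    case False
    then have "e = {x, y}"
      using that by (auto elim: simple_graph_edgeE[OF G(1)])
    then show ?thesis using that(1) by (auto intro: conn_edge)
  qed simp
  have "(u, v) \<in> conn (edges G)" if uv: "u \<in> verts G" "v \<in> verts G" for u v
  proof -
    obtain e f where e: "e \<in> edges G" "u \<in> e" and f: "f \<in> edges G" "v \<in> f"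
      using covered uv by meson
    then have "(e, f) \<in> conn (edges (line_graph G))"
      using G(2) graph_connected_iff_conn[OF simple_graph_line_graph[OF G(1)]]
      by (auto simp: line_graph_def)
    then have "\<forall>w\<in>f. (u, w) \<in> conn (edges G)"
    proof (induction rule: conn_induct)
      case refl
      show ?case using edge_conn e by blast
    next
      case (step g h)
      then obtain x where "x \<in> g" "x \<in> h" "h \<in> edges G"
        by (auto simp: line_graph_def doubleton_eq_iff)
      then show ?case using step.IH edge_conn conn_trans by metis
    qed
    then show ?thesis using f(2) by blast
  qed
  moreover obtain e where "e \<in> edges G"
    using G(2) by (auto simp: graph_connected_def line_graph_def)
  then have "verts G \<noteq> {}" using G(1) by (auto elim: simple_graph_edgeE)
  ultimately show ?thesis using graph_connected_iff_conn[OF G(1)] by blast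
qed

lemma k_connected_delete_verts:
  assumes "k_connected m H" "B \<subseteq> verts H" "card B < m"
  shows "graph_connected (delete_verts H B)"
proof -
  have "card B < (LEAST n. \<exists>S\<subseteq>verts H. card S = n \<and>
      (\<not> graph_connected (delete_verts H S) \<or> card (verts H - S) \<le> 1))"
    using assms(1,3) unfolding k_connected_def vertex_connectivity_def by linarith
  from not_less_Least[OF this] assms(2)
  show ?thesis by blast
qed

lemma card_nonisolating_edge_cut_ge:
  assumes G: "simple_graph G" "k_connected m (line_graph G)"
    and F: "is_edge_cut G F" "\<not> isolates_vertex G F"
  shows "m \<le> card F"
proof (rule ccontr)
  assume "\<not> m \<le> card F"
  then have "graph_connected (delete_verts (line_graph G) F)"
    using G(2) F(1) by (intro k_connected_delete_verts) (auto simp: is_edge_cut_def line_graph_def)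
  then have "graph_connected (line_graph (delete_edges G F))"
    by (simp add: delete_verts_line_graph)
  moreover have "\<exists>e\<in>edges (delete_edges G F). v \<in> e" if "v \<in> verts (delete_edges G F)" for v
    using F(2) that unfolding isolates_vertex_def delete_edges_def by simp
  ultimately have "graph_connected (delete_edges G F)"
    by (rule graph_connected_if_line_graph[OF simple_graph_delete_edges[OF G(1)]])
  then show False using F(1) by (simp add: is_edge_cut_def)
qed

lemma min_degree_le_card_isolating_edge_cut:
  assumes G: "simple_graph G" and F: "is_edge_cut G F" "isolates_vertex G F"
  shows "min_degree G \<le> card F"
proof -
  obtain v where v: "v \<in> verts G" "{e \<in> edges G. v \<in> e} \<subseteq> F"
    using F(2) by (auto simp: isolates_vertex_def delete_edges_def)
  have "min_degree G \<le> degree G v"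
    using G v(1) by (simp add: min_degree_def simple_graph_def)
  also have "\<dots> \<le> card F"
    unfolding degree_def using v(2) F(1) simple_graph_finite_edges[OF G]
    by (intro card_mono) (auto simp: is_edge_cut_def intro: finite_subset)
  finally show ?thesis .
qed

lemma k_edge_connected_if_line_graph:
  assumes G: "simple_graph G" "k_connected m (line_graph G)"
    and H: "(graph_connected G \<and> \<not> super_edge_connected G) \<or> m \<le> min_degree G"
  shows "k_edge_connected m G"
  unfolding k_edge_connected_def
proof (intro allI impI)
  fix F assume F: "is_edge_cut G F"
  from H show "m \<le> card F"
  proof
    assume "graph_connected G \<and> \<not> super_edge_connected G"
    then obtain F' where F': "is_minimum_edge_cut G F'" "\<not> isolates_vertex G F'"
      unfolding super_edge_connected_def by blast
    then have "m \<le> card F'"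
      using card_nonisolating_edge_cut_ge[OF G] by (simp add: is_minimum_edge_cut_def)
    also have "\<dots> \<le> card F" using F F'(1) by (simp add: is_minimum_edge_cut_def)
    finally show ?thesis .
  next
    assume "m \<le> min_degree G"
    then show ?thesis
      using card_nonisolating_edge_cut_ge[OF G F] min_degree_le_card_isolating_edge_cut[OF G(1) F]
      by linarith
  qed
qed

section \<open>Completely independent spanning trees\<close>

lemma completely_independent_spanning_treesI:
  assumes T: "edge_disjoint_spanning_trees H k T"
    and leaf: "\<And>i j x. i < k \<Longrightarrow> j < k \<Longrightarrow> i \<noteq> j \<Longrightarrow> x \<in> verts H \<Longrightarrow>
      degree (T i) x \<le> 1 \<or> degree (T j) x \<le> 1"
  shows "completely_independent_spanning_trees H k T"
  unfolding completely_independent_spanning_trees_def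
proof (intro conjI allI impI ballI)
  show tree: "spanning_tree H (T i)" if "i < k" for i
    using T that by (simp add: edge_disjoint_spanning_trees_def)
  fix u v i j p q
  assume ij: "i < k" "j < k" "i \<noteq> j" and pq: "is_path (T i) u p v \<and> is_path (T j) u q v"
  have "edges (T i) \<inter> edges (T j) = {}"
    using T ij by (auto simp: edge_disjoint_spanning_trees_def disjoint_family_on_def)
  then show "walk_edges p \<inter> walk_edges q = {}"
    using pq unfolding is_path_def is_walk_def by blast
  show "set p \<inter> set q \<subseteq> {u, v}"
  proof
    fix x assume x: "x \<in> set p \<inter> set q"
    have simple: "simple_graph (T i)" "simple_graph (T j)" and "verts (T i) = verts H"
      using tree ij by (auto simp: spanning_tree_def is_tree_def)
    then have "x \<in> verts H"
      using pq x by (auto simp: is_path_def is_walk_def)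
    then have "\<not> (2 \<le> degree (T i) x \<and> 2 \<le> degree (T j) x)"
      using leaf[OF ij, of x] by linarith
    then show "x \<in> {u, v}"
      using path_interior_degree_ge_2 simple pq x by (metis IntD1 IntD2 insertCI)
  qed
qed

definition induced_subgraph :: "'a ugraph \<Rightarrow> 'a set \<Rightarrow> 'a ugraph" where
  "induced_subgraph G A = \<lparr>verts = A, edges = {e \<in> edges G. e \<subseteq> A}\<rparr>"

lemma simple_graph_induced_subgraph:
  "simple_graph G \<Longrightarrow> A \<subseteq> verts G \<Longrightarrow> simple_graph (induced_subgraph G A)"
  by (auto simp: simple_graph_def induced_subgraph_def intro: finite_subset)

lemma edge_disjoint_attach_leaves:
  assumes AB: "A \<inter> B = {}"
    and f: "\<And>v. v \<in> V \<Longrightarrow> f v \<in> A" "\<And>v. v \<in> V - A \<Longrightarrow> f v = \<phi> v"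
    and g: "\<And>v. v \<in> W \<Longrightarrow> g v \<in> B" "\<And>v. v \<in> W - B \<Longrightarrow> g v = \<psi> v"
    and oriented: "\<And>v. v \<in> V \<inter> B \<Longrightarrow> \<psi> (\<phi> v) \<noteq> v"
  shows "(\<lambda>v. {v, f v}) ` V \<inter> (\<lambda>v. {v, g v}) ` W = {}"
proof (rule ccontr)
  assume "\<not> ?thesis"
  then obtain v w where v: "v \<in> V" and w: "w \<in> W" and eq: "{v, f v} = {w, g w}" by auto
  then have "v = g w" "w = f v"
    using AB f(1)[OF v] g(1)[OF w] by (auto simp: doubleton_eq_iff)
  then have "v \<in> B - A" "w \<in> A - B"
    using AB f(1)[OF v] g(1)[OF w] by auto
  then have "f v = \<phi> v" "g w = \<psi> w"
    using f(2) g(2) v w by blast+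
  then have "\<psi> (\<phi> v) = v" using \<open>v = g w\<close> \<open>w = f v\<close> by metis
  then show False using oriented v \<open>v \<in> B - A\<close> by blast
qed

lemma connected_dominating_set_parent_function:
  assumes H: "simple_graph H" and A: "A \<subseteq> verts H" "graph_connected (induced_subgraph H A)"
    and leaf: "\<And>v. v \<in> verts H - A \<Longrightarrow> \<phi> v \<in> A \<and> {v, \<phi> v} \<in> edges H"
  obtains r \<pi> where "parent_function (verts H) r \<pi>"
    "\<And>v. v \<in> verts H - {r} \<Longrightarrow> \<pi> v \<in> A \<and> {v, \<pi> v} \<in> edges H"
    "\<And>v. v \<in> verts H - A \<Longrightarrow> \<pi> v = \<phi> v"
proof -
  have simple: "simple_graph (induced_subgraph H A)"
    using H A(1) by (rule simple_graph_induced_subgraph)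
  obtain r where r: "r \<in> verts (induced_subgraph H A)"
    using A(2) by (auto simp: graph_connected_def)
  obtain \<pi> where "parent_function (verts (induced_subgraph H A)) r \<pi>"
    "\<And>v. v \<in> verts (induced_subgraph H A) - {r} \<Longrightarrow> {v, \<pi> v} \<in> edges (induced_subgraph H A)"
    by (rule graph_connected_parent_function[OF simple A(2) r]) blast
  then have \<pi>: "parent_function A r \<pi>" "\<And>v. v \<in> A - {r} \<Longrightarrow> {v, \<pi> v} \<in> edges H"
    by (auto simp: induced_subgraph_def)
  show thesis
  proof
    let ?\<pi> = "\<lambda>v. if v \<in> A then \<pi> v else \<phi> v"
    show "parent_function (verts H) r ?\<pi>"
      using \<pi>(1) A(1) leaf by (intro parent_function_attach_leaves) auto
    show "?\<pi> v \<in> A \<and> {v, ?\<pi> v} \<in> edges H" if "v \<in> verts H - {r}" for v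
      using parent_function_in[OF \<pi>(1)] \<pi>(2) leaf that by auto
  qed auto
qed

text \<open>A variant of Araki's criterion: \<open>A i\<close> contains the inner vertices of the \<open>i\<close>-th tree, in which
  every other vertex \<open>v\<close> hangs off \<open>\<phi> i v\<close> as a leaf. The last assumption says that no edge between
  \<open>A i\<close> and \<open>A j\<close> is chosen from both of its ends.\<close>
theorem completely_independent_spanning_trees_if_dominating_sets:
  assumes H: "simple_graph H"
    and A: "\<And>i. i < k \<Longrightarrow> A i \<subseteq> verts H" "disjoint_family_on A {..<k}"
    and connected: "\<And>i. i < k \<Longrightarrow> graph_connected (induced_subgraph H (A i))"
    and leaf: "\<And>i v. i < k \<Longrightarrow> v \<in> verts H - A i \<Longrightarrow> \<phi> i v \<in> A i \<and> {v, \<phi> i v} \<in> edges H"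
    and oriented: "\<And>i j v. i < k \<Longrightarrow> j < k \<Longrightarrow> i \<noteq> j \<Longrightarrow> v \<in> A j \<Longrightarrow> \<phi> j (\<phi> i v) \<noteq> v"
  shows "\<exists>T. completely_independent_spanning_trees H k T"
proof -
  have "\<exists>r \<pi>. parent_function (verts H) r \<pi> \<and>
      (\<forall>v\<in>verts H - {r}. \<pi> v \<in> A i \<and> {v, \<pi> v} \<in> edges H) \<and>
      (\<forall>v\<in>verts H - A i. \<pi> v = \<phi> i v)" if "i < k" for i
    by (rule connected_dominating_set_parent_function[OF H A(1) connected leaf])
      (use that in blast)+
  then obtain r \<pi> where \<pi>: "\<And>i. i < k \<Longrightarrow> parent_function (verts H) (r i) (\<pi> i)"
    and \<pi>_in: "\<And>i v. i < k \<Longrightarrow> v \<in> verts H - {r i} \<Longrightarrow> \<pi> i v \<in> A i"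
    and \<pi>_edge: "\<And>i v. i < k \<Longrightarrow> v \<in> verts H - {r i} \<Longrightarrow> {v, \<pi> i v} \<in> edges H"
    and \<pi>_leaf: "\<And>i v. i < k \<Longrightarrow> v \<in> verts H - A i \<Longrightarrow> \<pi> i v = \<phi> i v"
    by metis
  define T where "T i = parent_graph (verts H) (r i) (\<pi> i)" for i
  have "finite (verts H)" using H by (simp add: simple_graph_def)
  then have "spanning_tree H (T i)" if "i < k" for i
    using is_tree_parent_graph[OF _ \<pi>[OF that]] \<pi>_edge[OF that]
    by (auto simp: spanning_tree_def T_def parent_graph_def)
  moreover have "edges (T i) \<inter> edges (T j) = {}" if ij: "i < k" "j < k" "i \<noteq> j" for i j
    unfolding T_def parent_graph_def ugraph.simps
  proof (rule edge_disjoint_attach_leaves[where \<phi> = "\<phi> i" and \<psi> = "\<phi> j"])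
    show "A i \<inter> A j = {}" using disjoint_family_onD[OF A(2)] ij by simp
    show "\<phi> j (\<phi> i v) \<noteq> v" if "v \<in> (verts H - {r i}) \<inter> A j" for v
      using oriented[OF ij] that by blast
  qed (simp_all add: ij \<pi>_in \<pi>_leaf)
  ultimately have trees: "edge_disjoint_spanning_trees H k T"
    by (auto simp: edge_disjoint_spanning_trees_def disjoint_family_on_def)
  have degree_le: "degree (T i) x \<le> 1" if "i < k" "x \<notin> A i" for i x
    unfolding T_def using \<pi>_in that by (intro degree_parent_graph_le_1) blast
  have "degree (T i) x \<le> 1 \<or> degree (T j) x \<le> 1" if "i < k" "j < k" "i \<noteq> j" for i j x
    using degree_le[of i x] degree_le[of j x] disjoint_family_onD[OF A(2), of i j] that by auto
  with trees have "completely_independent_spanning_trees H k T"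
    by (rule completely_independent_spanning_treesI)
  then show ?thesis by blast
qed

lemma induced_subgraph_line_graph:
  assumes "spanning_tree G T"
  shows "induced_subgraph (line_graph G) (edges T) = line_graph T"
proof -
  have "edges T \<subseteq> edges G" using assms by (simp add: spanning_tree_def)
  have "{x \<in> edges (line_graph G). x \<subseteq> edges T} = edges (line_graph T)"
  proof (intro equalityI subsetI CollectI)
    fix x assume "x \<in> {x \<in> edges (line_graph G). x \<subseteq> edges T}"
    then show "x \<in> edges (line_graph T)"
      by (auto elim!: edges_line_graphE intro: edges_line_graphI)
  next
    fix x assume "x \<in> edges (line_graph T)"
    then show "x \<in> edges (line_graph G) \<and> x \<subseteq> edges T"
      using \<open>edges T \<subseteq> edges G\<close> by (auto elim!: edges_line_graphE intro: edges_line_graphI)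
  qed
  then show ?thesis by (simp add: induced_subgraph_def line_graph_def)
qed

lemma spanning_tree_parent_edges:
  assumes "spanning_tree G T" "r \<in> verts G"
  obtains p where "inj_on p (verts G - {r})" "\<And>v. v \<in> verts G - {r} \<Longrightarrow> v \<in> p v \<and> p v \<in> edges T"
proof -
  have "simple_graph T" "graph_connected T" and verts: "verts T = verts G"
    using assms(1) by (auto simp: spanning_tree_def is_tree_def)
  then obtain \<pi> where "parent_function (verts G) r \<pi>"
    "\<And>v. v \<in> verts G - {r} \<Longrightarrow> {v, \<pi> v} \<in> edges T"
    using graph_connected_parent_function[of T r] assms(2) unfolding verts by metis
  then show thesis
    by (intro that[of "\<lambda>v. {v, \<pi> v}"] inj_on_parent_edge) auto
qed

text \<open>The two ends of an edge that avoids \<open>r\<close> cannot both own it as parent edge: in the same tree by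
  injectivity, in different trees by disjointness.\<close>
lemma edge_end_not_owner_exists:
  assumes G: "simple_graph G" and T: "edge_disjoint_spanning_trees G k T"
    and inj: "\<And>i. i < k \<Longrightarrow> inj_on (p i) (verts G - {r})"
    and p: "\<And>i v. i < k \<Longrightarrow> v \<in> verts G - {r} \<Longrightarrow> p i v \<in> edges (T i)"
  obtains a where "\<And>e. e \<in> edges G \<Longrightarrow> a e \<in> e \<and> a e \<in> verts G - {r}"
    "\<And>e i. e \<in> edges G \<Longrightarrow> i < k \<Longrightarrow> e = p i (a e) \<Longrightarrow> r \<in> e"
proof -
  have "\<exists>x\<in>e. x \<in> verts G - {r} \<and> (\<forall>i<k. e = p i x \<longrightarrow> r \<in> e)" if e: "e \<in> edges G" for e
  proof -
    obtain u v where uv: "e = {u, v}" "u \<noteq> v" "u \<in> verts G" "v \<in> verts G"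
      by (rule simple_graph_edgeE[OF G e])
    show ?thesis
    proof (cases "r \<in> e")
      case False
      then have uv': "u \<in> verts G - {r}" "v \<in> verts G - {r}" using uv by auto
      have "p i u \<noteq> p j v" if "i < k" "j < k" for i j
      proof (cases "i = j")
        case True
        then show ?thesis using inj_onD[OF inj] uv' uv(2) that by metis
      next
        case False
        then have "edges (T i) \<inter> edges (T j) = {}"
          using T that by (auto simp: edge_disjoint_spanning_trees_def disjoint_family_on_def)
        then show ?thesis using p uv' that by (metis disjoint_iff)
      qed
      then have "(\<forall>i<k. e \<noteq> p i u) \<or> (\<forall>i<k. e \<noteq> p i v)" by metis
      then show ?thesis using uv' uv(1) by blast
    qed (use uv in auto)
  qed
  then show thesis using that by metis
qed

text \<open>With \<open>a\<close> as above, \<open>\<phi> i e\<close> is the edge that \<open>a e\<close> owns in the \<open>i\<close>-th tree. Two edges choosing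
  each other would share the end chosen by both, which owns both, and hence also the end \<open>r\<close>.\<close>
lemma adjacent_tree_edges_exist:
  assumes G: "simple_graph G" "edges G \<noteq> {}" and T: "edge_disjoint_spanning_trees G k T"
  obtains \<phi> where "\<And>i e. i < k \<Longrightarrow> e \<in> edges G \<Longrightarrow> \<phi> i e \<in> edges (T i) \<and> e \<inter> \<phi> i e \<noteq> {}"
    "\<And>i j e. i < k \<Longrightarrow> j < k \<Longrightarrow> i \<noteq> j \<Longrightarrow> e \<in> edges (T j) \<Longrightarrow> \<phi> j (\<phi> i e) \<noteq> e"
proof -
  have tree: "spanning_tree G (T i)" and sub: "edges (T i) \<subseteq> edges G" if "i < k" for i
    using T that by (auto simp: edge_disjoint_spanning_trees_def spanning_tree_def)
  obtain r where r: "r \<in> verts G"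
    using G by (meson equals0I simple_graph_edgeE)
  have "\<exists>p. inj_on p (verts G - {r}) \<and> (\<forall>v\<in>verts G - {r}. v \<in> p v \<and> p v \<in> edges (T i))"
    if "i < k" for i
    using spanning_tree_parent_edges[OF tree[OF that] r] by metis
  then obtain p where inj: "\<And>i. i < k \<Longrightarrow> inj_on (p i) (verts G - {r})"
    and p: "\<And>i v. i < k \<Longrightarrow> v \<in> verts G - {r} \<Longrightarrow> v \<in> p i v \<and> p i v \<in> edges (T i)"
    by metis
  then obtain a where a: "\<And>e. e \<in> edges G \<Longrightarrow> a e \<in> e \<and> a e \<in> verts G - {r}"
    and owner: "\<And>e i. e \<in> edges G \<Longrightarrow> i < k \<Longrightarrow> e = p i (a e) \<Longrightarrow> r \<in> e"
    using edge_end_not_owner_exists[OF G(1) T, of p r] by metis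
  have "p j (a (p i (a e))) \<noteq> e" if ij: "i < k" "j < k" "i \<noteq> j" and e: "e \<in> edges (T j)" for i j e
  proof
    define f where "f = p i (a e)"
    assume "p j (a (p i (a e))) = e"
    then have mutual: "e = p j (a f)" by (simp add: f_def)
    have eG: "e \<in> edges G" using sub ij e by blast
    have f: "a e \<in> f" "f \<in> edges (T i)" using p[OF ij(1)] a[OF eG] by (auto simp: f_def)
    have fG: "f \<in> edges G" using sub ij f by blast
    have "e \<noteq> f"
      using T ij e f by (auto simp: edge_disjoint_spanning_trees_def disjoint_family_on_def)
    then have common: "x = y" if "{x, y} \<subseteq> e \<inter> f" for x y
      using simple_graph_edge_eqI[OF G(1) eG fG that] by blast
    have "a f \<in> e" using p[OF ij(2)] a[OF fG] mutual by metis
    then have same: "a e = a f" using common[of "a e" "a f"] a[OF eG] a[OF fG] f(1) by blast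
    have "r \<in> e" using owner[OF eG ij(2)] mutual same by simp
    moreover have "f = p i (a f)" unfolding same[symmetric] by (rule f_def)
    then have "r \<in> f" using owner[OF fG ij(1)] by blast
    ultimately have "a e = r" using common[of "a e" r] a[OF eG] f(1) by blast
    then show False using a[OF eG] by blast
  qed
  moreover have "p i (a e) \<in> edges (T i) \<and> e \<inter> p i (a e) \<noteq> {}" if "i < k" "e \<in> edges G" for i e
    using a[OF that(2)] p[OF that(1)] by blast
  ultimately show thesis
    by (intro that[of "\<lambda>i e. p i (a e)"])
qed

theorem line_graph_completely_independent_spanning_trees:
  assumes G: "simple_graph G" "edges G \<noteq> {}" and T: "edge_disjoint_spanning_trees G k T"
  shows "\<exists>T. completely_independent_spanning_trees (line_graph G) k T"
proof -
  have tree: "spanning_tree G (T i)" and sub: "edges (T i) \<subseteq> edges G" if "i < k" for i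
    using T that by (auto simp: edge_disjoint_spanning_trees_def spanning_tree_def)
  obtain \<phi> where \<phi>: "\<And>i e. i < k \<Longrightarrow> e \<in> edges G \<Longrightarrow> \<phi> i e \<in> edges (T i) \<and> e \<inter> \<phi> i e \<noteq> {}"
    and oriented: "\<And>i j e. i < k \<Longrightarrow> j < k \<Longrightarrow> i \<noteq> j \<Longrightarrow> e \<in> edges (T j) \<Longrightarrow> \<phi> j (\<phi> i e) \<noteq> e"
    using adjacent_tree_edges_exist[OF G T] by metis
  show ?thesis
  proof (rule completely_independent_spanning_trees_if_dominating_sets[OF _ _ _ _ _ oriented])
    show "simple_graph (line_graph G)" using G(1) by (rule simple_graph_line_graph)
    show "disjoint_family_on (\<lambda>i. edges (T i)) {..<k}"
      using T by (simp add: edge_disjoint_spanning_trees_def)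
    fix i assume i: "i < k"
    show "edges (T i) \<subseteq> verts (line_graph G)" using sub[OF i] by (simp add: line_graph_def)
    have "simple_graph (T i)" "graph_connected (T i)" "edges (T i) \<noteq> {}"
      using tree[OF i] \<phi>[OF i] G(2) by (auto simp: spanning_tree_def is_tree_def)
    then show "graph_connected (induced_subgraph (line_graph G) (edges (T i)))"
      unfolding induced_subgraph_line_graph[OF tree[OF i]] by (rule graph_connected_line_graph)
    fix e assume "e \<in> verts (line_graph G) - edges (T i)"
    then have e: "e \<in> edges G" "e \<notin> edges (T i)" by (auto simp: line_graph_def)
    then obtain x where "x \<in> e \<inter> \<phi> i e" using \<phi>[OF i] by blast
    then have "{e, \<phi> i e} \<in> edges (line_graph G)"
      using \<phi>[OF i e(1)] e sub[OF i] by (intro edges_line_graphI[of _ _ _ x]) auto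
    then show "\<phi> i e \<in> edges (T i) \<and> {e, \<phi> i e} \<in> edges (line_graph G)"
      using \<phi>[OF i e(1)] by blast
  qed
qed

theorem theorem11:
  fixes k :: nat and G :: "'a ugraph" and S :: "'a set set"
  assumes "k > 0"
    and "simple_graph G"
    and "k_connected (2 * k) (line_graph G)"
    and "S \<subset> verts (line_graph G)"
    and "card S \<le> k"
    and "(graph_connected G \<and> \<not> super_edge_connected G) \<or> min_degree G \<ge> 2 * k"
  shows "\<exists>T. completely_independent_spanning_trees (delete_verts (line_graph G) S) k T"
proof -
  have S: "S \<subset> edges G" using assms(4) by (simp add: line_graph_def)
  then have "finite S"
    using simple_graph_finite_edges[OF assms(2)] by (auto intro: finite_subset)
  have "verts G \<noteq> {}"
    using S assms(2) by (auto elim: simple_graph_edgeE)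
  moreover have "k_edge_connected (2 * k) G"
    using assms(2,3,6) by (rule k_edge_connected_if_line_graph)
  ultimately obtain T where "edge_disjoint_spanning_trees (delete_edges G S) k T"
    using k_edge_connected_edge_disjoint_spanning_trees[OF assms(2)] \<open>finite S\<close> assms(5) by blast
  moreover have "edges (delete_edges G S) \<noteq> {}"
    using S by (auto simp: delete_edges_def)
  ultimately show ?thesis
    unfolding delete_verts_line_graph
    using line_graph_completely_independent_spanning_trees simple_graph_delete_edges[OF assms(2)]
    by blast
qed

end
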